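(* Consider the multi-queue bandit and the algorithm Q-ThS(match) described in the context, with any problem instance $(\boldsymbol\lambda,\boldsymbol\mu)$ satisfying the stated assumptions. For $u\in[U]$ let $$w(t)=\exp\left(\left(\frac{2\log t}{\Delta}\right)^{2/3}\right),\quad v'_u(t)=\frac{6K}{\epsilon_u}w(t),\quad v_u(t)=\frac{24}{\epsilon_u^2}\log t+\frac{60K}{\epsilon_u}\frac{v'_u(t)\log^2 t}{t}.$$ Then there exist constants $C>0$ and $t_0$, not depending on $K$ or on the $\epsilon_u$, such that under Q-ThS(match), for every $u\in[U]$, $$\Psi_u(t)\le C\,\frac{K\,v_u(t)\log^2 t}{t}$$ for all $t>t_0$ satisfying $\frac{w(t)}{\log t}\ge\frac{2}{\epsilon_u}$, $t\ge\exp(6/\Delta^2)$ and $v_u(t)+v'_u(t)\le t/2$.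
   Context: Discrete-time system with $U$ queues and $K$ servers, $1\le U\le K$. Arrivals $A_u(t)\in\{0,1\}$ to queue $u$ are Bernoulli($\lambda_u$), and the service $R_{uk}(t)\in\{0,1\}$ that server $k$ offers queue $u$ at time $t$ is Bernoulli($\mu_{uk}$); all these variables are mutually independent and i.i.d. across time slots. In each slot a matching between queues and servers is scheduled (each server serves at most one queue, each queue is served by at most one server); $\kappa_u(t)$ denotes the server assigned to queue $u$, $S_u(t)=R_{u\kappa_u(t)}(t)$ (0 if unassigned), and $Q_u(t)=(Q_u(t-1)+A_u(t)-S_u(t))^+$. Decisions are based only on past observations. Assumptions: for each $u$, $\mu^*_u=\max_k\mu_{uk}$ is attained at a unique server $k^*_u$; $k^*_u\ne k^*_{u'}$ for $u\ne u'$; and $\epsilon_u=\mu^*_u-\lambda_u>0$. The genie queue $Q^*_u$ uses the same arrivals and always server $k^*_u$. $Q_u(0)$ and $Q^*_u(0)$ are both distributed according to the stationary distribution of $Q^*_u$. Regret: $\Psi_u(t)=\mathbb{E}[Q_u(t)-Q^*_u(t)]$. $\Delta=\min_{u,\,k\ne k^*_u}(\mu^*_u-\mu_{uk})$. Algorithm Q-ThS(match): $\mathcal E$ is a fixed set of $K$ matchings which together cover every pair $(u,k)$. $T_{uk}(t)$ is the number of slots in $\{1,\dots,t\}$ in which server $k$ was assigned to queue $u$, and $\hat\mu_{uk}(t)$ the empirical mean of observed services of pair $(u,k)$ before $t$. At time $t$ draw an independent Bernoulli $\mathsf E(t)$ of mean $\min\{1,3K\log^2t/t\}$. If $\mathsf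 E(t)=1$, schedule a matching from $\mathcal E$ uniformly at random. Otherwise draw independently $\hat\theta_{uk}(t)\sim\mathrm{Beta}(\hat\mu_{uk}(t)T_{uk}(t-1)+1,(1-\hat\mu_{uk}(t))T_{uk}(t-1)+1)$, let $\hat k_u(t)=\arg\max_k\hat\theta_{uk}(t)$, and schedule a matching $\boldsymbol\kappa(t)$ minimizing $\sum_u\mathbf 1\{\kappa_u\ne\hat k_u(t)\}$ over all matchings. *)

theory Defs
  imports "HOL-Probability.Probability" "HOL-Probability.Product_PMF"
begin

text \<open>Queues are indexed by u < U, servers by k < K.  A matching is a partial map
  from queues to servers (queue u is unassigned iff its value is None); each queue is
  served by at most one server and each server serves at most one queue.\<close>

definition is_matching :: "nat \<Rightarrow> nat \<Rightarrow> (nat \<Rightarrow> nat option) \<Rightarrow> bool" where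
  "is_matching U K \<kappa> \<longleftrightarrow>
     (\<forall>u. \<kappa> u \<noteq> None \<longrightarrow> u < U) \<and> (\<forall>u k. \<kappa> u = Some k \<longrightarrow> k < K) \<and>
     inj_on \<kappa> {u. \<kappa> u \<noteq> None}"

definition mismatch :: "nat \<Rightarrow> (nat \<Rightarrow> nat option) \<Rightarrow> (nat \<Rightarrow> nat) \<Rightarrow> nat" where
  "mismatch U \<kappa> kh = card {u \<in> {..<U}. \<kappa> u \<noteq> Some (kh u)}"

definition mustar :: "nat \<Rightarrow> (nat \<Rightarrow> nat \<Rightarrow> real) \<Rightarrow> nat \<Rightarrow> real" where
  "mustar K mu u = Max ((mu u) ` {..<K})"

definition kstar :: "nat \<Rightarrow> (nat \<Rightarrow> nat \<Rightarrow> real) \<Rightarrow> nat \<Rightarrow> nat" where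
  "kstar K mu u = (THE k. k < K \<and> mu u k = mustar K mu u)"

definition epsq :: "nat \<Rightarrow> (nat \<Rightarrow> real) \<Rightarrow> (nat \<Rightarrow> nat \<Rightarrow> real) \<Rightarrow> nat \<Rightarrow> real" where
  "epsq K lam mu u = mustar K mu u - lam u"

definition gapDelta :: "nat \<Rightarrow> nat \<Rightarrow> (nat \<Rightarrow> nat \<Rightarrow> real) \<Rightarrow> real" where
  "gapDelta U K mu = Min {mustar K mu u - mu u k | u k. u < U \<and> k < K \<and> k \<noteq> kstar K mu u}"

definition queue_stationary :: "real \<Rightarrow> real \<Rightarrow> nat pmf \<Rightarrow> bool" where
  "queue_stationary la m p \<longleftrightarrow>
     p = bind_pmf p (\<lambda>q. bind_pmf (bernoulli_pmf la) (\<lambda>a.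
           map_pmf (\<lambda>s. (q + of_bool a) - of_bool s) (bernoulli_pmf m)))"

definition beta_M :: "real \<Rightarrow> real \<Rightarrow> real measure" where
  "beta_M a b = density lborel (\<lambda>x. ennreal (indicator {0<..<1} x *
       x powr (a - 1) * (1 - x) powr (b - 1) / Beta a b))"

text \<open>State of the system after slot t: per pair (u,k) the numbers of observed
  successes / failures of service (slots 1..t), the queue lengths Q_u(t) of the
  algorithm and the genie queue lengths Q*_u(t).\<close>
record qstate =
  succ :: "nat \<Rightarrow> nat \<Rightarrow> nat"
  fail :: "nat \<Rightarrow> nat \<Rightarrow> nat"
  Qa :: "nat \<Rightarrow> nat"
  Qg :: "nat \<Rightarrow> nat"

definition qupd :: "nat \<Rightarrow> (nat \<Rightarrow> nat) \<Rightarrow> qstate \<Rightarrow> (nat \<Rightarrow> nat option)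
    \<Rightarrow> (nat \<Rightarrow> bool) \<Rightarrow> (nat \<times> nat \<Rightarrow> bool) \<Rightarrow> qstate" where
  "qupd U ks s \<kappa> A R =
     \<lparr> succ = (\<lambda>u k. succ s u k + of_bool (u < U \<and> \<kappa> u = Some k \<and> R (u, k))),
       fail = (\<lambda>u k. fail s u k + of_bool (u < U \<and> \<kappa> u = Some k \<and> \<not> R (u, k))),
       Qa = (\<lambda>u. (Qa s u + of_bool (A u)) -
                 (case \<kappa> u of None \<Rightarrow> 0 | Some k \<Rightarrow> of_bool (R (u, k)))),
       Qg = (\<lambda>u. (Qg s u + of_bool (A u)) - of_bool (R (u, ks u))) \<rparr>"

text \<open>Index of the largest sample (smallest index among maximisers; ties have
  probability zero).\<close>
definition khat :: "nat \<Rightarrow> (nat \<times> nat \<Rightarrow> real) \<Rightarrow> nat \<Rightarrow> nat" where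
  "khat K \<theta> u = (LEAST k. k < K \<and> (\<forall>j<K. \<theta> (u, j) \<le> \<theta> (u, k)))"

definition explore_prob :: "nat \<Rightarrow> nat \<Rightarrow> real" where
  "explore_prob K t = min 1 (3 * real K * (ln (real t))^2 / real t)"

text \<open>One slot t of the system under Q-ThS(match).  Em i (i < K) is the exploration
  set of matchings; sel t s kh is the (arbitrary) matching chosen by the algorithm
  among those minimising the mismatch with kh.\<close>
definition qths_step :: "nat \<Rightarrow> nat \<Rightarrow> (nat \<Rightarrow> real) \<Rightarrow> (nat \<Rightarrow> nat \<Rightarrow> real)
    \<Rightarrow> (nat \<Rightarrow> nat \<Rightarrow> nat option) \<Rightarrow> (nat \<Rightarrow> qstate \<Rightarrow> (nat \<Rightarrow> nat) \<Rightarrow> nat \<Rightarrow> nat option)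
    \<Rightarrow> nat \<Rightarrow> qstate \<Rightarrow> qstate measure" where
  "qths_step U K lam mu Em sel t s =
     measure_pmf (Pi_pmf {..<U} False (\<lambda>u. bernoulli_pmf (lam u))) \<bind> (\<lambda>A.
     measure_pmf (Pi_pmf ({..<U} \<times> {..<K}) False (\<lambda>(u, k). bernoulli_pmf (mu u k))) \<bind> (\<lambda>R.
     measure_pmf (bernoulli_pmf (explore_prob K t)) \<bind> (\<lambda>e.
       if e then
         measure_pmf (pmf_of_set {..<K}) \<bind> (\<lambda>i.
           return (count_space UNIV) (qupd U (kstar K mu) s (Em i) A R))
       else
         PiM ({..<U} \<times> {..<K})
             (\<lambda>(u, k). beta_M (real (succ s u k) + 1) (real (fail s u k) + 1)) \<bind> (\<lambda>\<theta>.
           return (count_space UNIV) (qupd U (kstar K mu) s (sel t s (khat K \<theta>)) A R)))))"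

text \<open>Law of the state at time t; initial queues Q_u(0) = Q*_u(0) drawn from the
  stationary distribution st u of the genie queue, independently of everything else.\<close>
primrec qths_law :: "nat \<Rightarrow> nat \<Rightarrow> (nat \<Rightarrow> real) \<Rightarrow> (nat \<Rightarrow> nat \<Rightarrow> real)
    \<Rightarrow> (nat \<Rightarrow> nat \<Rightarrow> nat option) \<Rightarrow> (nat \<Rightarrow> qstate \<Rightarrow> (nat \<Rightarrow> nat) \<Rightarrow> nat \<Rightarrow> nat option)
    \<Rightarrow> (nat \<Rightarrow> nat pmf) \<Rightarrow> nat \<Rightarrow> qstate measure" where
  "qths_law U K lam mu Em sel st 0 =
     measure_pmf (Pi_pmf {..<U} 0 st) \<bind> (\<lambda>q.
       return (count_space UNIV) \<lparr> succ = (\<lambda>_ _. 0), fail = (\<lambda>_ _. 0), Qa = q, Qg = q \<rparr>)"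
| "qths_law U K lam mu Em sel st (Suc t) =
     qths_law U K lam mu Em sel st t \<bind> qths_step U K lam mu Em sel (Suc t)"

definition regret :: "nat \<Rightarrow> nat \<Rightarrow> (nat \<Rightarrow> real) \<Rightarrow> (nat \<Rightarrow> nat \<Rightarrow> real)
    \<Rightarrow> (nat \<Rightarrow> nat \<Rightarrow> nat option) \<Rightarrow> (nat \<Rightarrow> qstate \<Rightarrow> (nat \<Rightarrow> nat) \<Rightarrow> nat \<Rightarrow> nat option)
    \<Rightarrow> (nat \<Rightarrow> nat pmf) \<Rightarrow> nat \<Rightarrow> nat \<Rightarrow> real" where
  "regret U K lam mu Em sel st u t =
     (\<integral>s. real (Qa s u) - real (Qg s u) \<partial>qths_law U K lam mu Em sel st t)"

definition wfun :: "real \<Rightarrow> nat \<Rightarrow> real" where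
  "wfun D t = exp ((2 * ln (real t) / D) powr (2/3))"

definition vpfun :: "nat \<Rightarrow> real \<Rightarrow> real \<Rightarrow> nat \<Rightarrow> real" where
  "vpfun K e D t = 6 * real K / e * wfun D t"

definition vfun :: "nat \<Rightarrow> real \<Rightarrow> real \<Rightarrow> nat \<Rightarrow> real" where
  "vfun K e D t = 24 / e^2 * ln (real t)
     + 60 * real K / e * (vpfun K e D t * (ln (real t))^2 / real t)"

end

theory Submission
  imports Defs "HOL-Real_Asymp.Real_Asymp"
begin

text \<open>
  Write e for the slack of the queue u under consideration and call a slot bad if u is not
  assigned its best server. A bad slot either explores or exploits erroneously. Let tau be about
  K w(t), m about t - v(t), and let X be arrival minus genie service plus the indicator of a bad
  slot. Unfolding the Lindley recursion shows that, unless one of the sums of X over a window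
  (r, t] with tau \<le> r < m is positive (for r = tau: unless the sum plus the initial length plus tau is
  positive), the queue exceeds the genie queue by at most the number of bad slots in (m, t].
  The expected number of exploring slots there has the order K v(t) log^2 t / t. The sums
  have drift close to -e because the exploration probability is small compared with e on average,
  so exponential moments bound the exceptional event by t^-2.

  Erroneous exploitation is negligible after tau: by then every pair has been sampled at
  least (log w(t))^2 / 4 times, which is of order (log t)^(4/3), and both the empirical means
  and the Beta samples concentrate exponentially fast in that number.
\<close>

section \<open>Beta distributions and the stationary queue\<close>

text \<open>Exploration and erroneous exploitation need different arguments. The exploration coin
  has a law independent of the history, so its indicator can enter the exponential moments together
  with arrival and service. An exploitation error depends on all past observations and on all queues
  at once; a single one after tau is therefore counted as exceptional. This is affordable: each such
  slot errs with probability at most t^-5, and the excess over the genie queue never exceeds t.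

  The exponent parameter is e itself. Hoeffding's lemma for one arrival and one service turns the
  drift -e per slot into the exponent -e^2 + e^2/4, and exploration gives back at most e^2/4 on
  average, so a window of length n contributes at most exp (- e^2 n / 2). The term 24 log t / e^2 of
  v(t) makes this at most t^-12 for each window that starts before m. Up to tau only the bound of
  one arrival per slot is used; the resulting backlog is drained by time t because v'(t) <= t/2
  forces tau <= e t / 6.

  The threshold t0 depends on Delta alone and the factor 12 is absolute.\<close>

lemma bernoulli_mgf_le:
  fixes p h :: real
  assumes "0 \<le> p" "p \<le> 1"
  shows "(1 - p) + p * exp h \<le> exp (h * p + h\<^sup>2 / 8)"
proof -
  have main: "(1 - q) + q * exp g \<le> exp (g * q + g\<^sup>2 / 8)"
    if "0 \<le> q" "q \<le> 1" "g \<ge> 0" for q g :: real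
  proof -
    have pos: "1 + q * (exp g - 1) > 0"
      using that by (intro add_pos_nonneg mult_nonneg_nonneg) auto
    have "ln (1 + q * (exp g - 1)) \<le> g * q + g\<^sup>2 / 8"
      using Hoeffdings_lemma_aux[of g q] that by simp
    hence "1 + q * (exp g - 1) \<le> exp (g * q + g\<^sup>2 / 8)"
      using pos by (metis exp_le_cancel_iff exp_ln)
    thus ?thesis by (simp add: algebra_simps)
  qed
  show ?thesis
  proof (cases "h \<ge> 0")
    case True
    thus ?thesis using main[of p h] assms by simp
  next
    case False
    \<comment> \<open>Exchanging success and failure replaces (p, h) by (1 - p, - h) at the cost of
      a factor exp h.\<close>
    have "(1 - (1 - p)) + (1 - p) * exp (-h) \<le> exp ((-h) * (1 - p) + (-h)\<^sup>2 / 8)"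
      by (rule main) (use False assms in auto)
    hence "exp h * ((1 - (1 - p)) + (1 - p) * exp (-h)) \<le> exp h * exp ((-h) * (1 - p) + (-h)\<^sup>2 / 8)"
      by (intro mult_left_mono) auto
    thus ?thesis
      by (simp add: algebra_simps flip: exp_add)
  qed
qed

lemma Beta_of_nat: "Beta (real a + 1) (real b + 1) = fact a * fact b / fact (a + b + 1)"
proof -
  have "Gamma (real a + 1 + (real b + 1)) = fact (a + b + 1)"
    using Gamma_fact[of "a + b + 1", where 'a = real] by (simp add: algebra_simps)
  moreover have "Gamma (real a + 1) = fact a" "Gamma (real b + 1) = fact b"
    using Gamma_fact[of a, where 'a = real] Gamma_fact[of b, where 'a = real]
    by (simp_all add: algebra_simps)
  ultimately show ?thesis unfolding Beta_def by simp
qed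

lemma Beta_of_nat_pos: "Beta (real a + 1) (real b + 1) > 0"
  by (simp add: Beta_of_nat)

lemma sets_beta_M [measurable_cong]: "sets (beta_M a b) = sets borel"
  by (simp add: beta_M_def)

lemma space_beta_M [simp]: "space (beta_M a b) = UNIV"
  by (simp add: beta_M_def)

lemma prob_space_beta_M: "prob_space (beta_M (real a + 1) (real b + 1))"
proof
  define B where "B = Beta (real a + 1) (real b + 1)"
  have B: "B > 0" by (simp add: B_def Beta_of_nat_pos)
  have "((\<lambda>t. t powr (real a + 1 - 1) * (1 - t) powr (real b + 1 - 1)) has_integral B) {0<..<1}"
    using has_integral_Beta_real[of "real a + 1" "real b + 1"]
    by (simp add: B_def has_integral_Icc_iff_Ioo)
  hence "((\<lambda>t. t powr real a * (1 - t) powr real b / B) has_integral B / B) {0<..<1}"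
    by (intro has_integral_divide) simp
  hence hi: "((\<lambda>t. t powr real a * (1 - t) powr real b / B) has_integral 1) {0<..<1}"
    using B by simp
  have "(\<integral>\<^sup>+x. ennreal (x powr real a * (1 - x) powr real b / B) * indicator {0<..<1} x \<partial>lborel) = 1"
    using nn_integral_has_integral_lebesgue[OF _ hi] B
    by (auto simp: mult_ac simp flip: ennreal_indicator ennreal_mult')
  moreover have "emeasure (beta_M (real a + 1) (real b + 1)) (space (beta_M (real a + 1) (real b + 1)))
     = (\<integral>\<^sup>+x. ennreal (x powr real a * (1 - x) powr real b / B) * indicator {0<..<1} x \<partial>lborel)"
    unfolding space_beta_M unfolding beta_M_def B_def[symmetric]
    by (subst emeasure_density)
       (auto intro!: nn_integral_cong simp: indicator_def)
  ultimately show "emeasure (beta_M (real a + 1) (real b + 1)) (space (beta_M (real a + 1) (real b + 1))) = 1"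
    by simp
qed

text \<open>The posterior density of a success probability x is (T + 1) times the likelihood of the
  observed counts, i.e. a binomial probability, so Hoeffding's inequality controls its tails.\<close>
lemma beta_density_le:
  fixes x d :: real
  assumes x: "0 < x" "x < 1" and T: "a + b > 0" and d: "d \<ge> 0" "d \<le> \<bar>x - real a / real (a + b)\<bar>"
  shows "x powr real a * (1 - x) powr real b / Beta (real a + 1) (real b + 1)
           \<le> real (a + b + 1) * (2 * exp (-2 * real (a + b) * d\<^sup>2))"
proof -
  interpret binomial_distribution "a + b" x
    by unfold_locales (use x in auto)
  have "pmf (binomial_pmf (a + b) x) a \<le> measure_pmf.prob (binomial_pmf (a + b) x) {y. \<bar>real y / real (a + b) - x\<bar> \<ge> d}"
    unfolding measure_pmf_single[symmetric]
    by (intro measure_pmf.finite_measure_mono) (use d in auto)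
  also have "\<dots> \<le> 2 * exp (-2 * real (a + b) * d\<^sup>2)"
    using prob_abs_ge'[of d] d T by simp
  finally have *: "pmf (binomial_pmf (a + b) x) a \<le> 2 * exp (-2 * real (a + b) * d\<^sup>2)" .
  have "x powr real a * (1 - x) powr real b / Beta (real a + 1) (real b + 1)
        = real (a + b + 1) * pmf (binomial_pmf (a + b) x) a"
    using x unfolding Beta_of_nat
    by (simp add: powr_realpow binomial_fact divide_simps)
  also have "\<dots> \<le> real (a + b + 1) * (2 * exp (-2 * real (a + b) * d\<^sup>2))"
    by (intro mult_left_mono *) auto
  finally show ?thesis .
qed

text \<open>The density lives on an interval of length 1, so a uniform bound on it off the centre is
  also a bound on the mass there.\<close>

lemma beta_M_tail:
  assumes T: "a + b > 0" and d: "d \<ge> 0"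
  shows "emeasure (beta_M (real a + 1) (real b + 1)) {x. d \<le> \<bar>x - real a / real (a + b)\<bar>}
          \<le> ennreal (real (a + b + 1) * (2 * exp (-2 * real (a + b) * d\<^sup>2)))" (is "_ \<le> ennreal ?c")
proof -
  let ?S = "{x. d \<le> \<bar>x - real a / real (a + b)\<bar>}"
  have "emeasure (beta_M (real a + 1) (real b + 1)) ?S
      = (\<integral>\<^sup>+x. ennreal (indicator {0<..<1} x * x powr (real a + 1 - 1) * (1 - x) powr (real b + 1 - 1) /
           Beta (real a + 1) (real b + 1)) * indicator ?S x \<partial>lborel)"
    unfolding beta_M_def by (subst emeasure_density) auto
  also have "\<dots> \<le> (\<integral>\<^sup>+x. ennreal ?c * indicator {0<..<1::real} x \<partial>lborel)"
  proof (intro nn_integral_mono)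
    fix x :: real
    show "ennreal (indicator {0<..<1} x * x powr (real a + 1 - 1) * (1 - x) powr (real b + 1 - 1) /
           Beta (real a + 1) (real b + 1)) * indicator ?S x \<le> ennreal ?c * indicator {0<..<1} x"
      using beta_density_le[OF _ _ T d, of x]
      by (auto simp: indicator_def simp del: of_nat_add intro!: ennreal_leI)
  qed
  also have "\<dots> = ennreal ?c"
    by (subst nn_integral_cmult_indicator) auto
  finally show ?thesis .
qed

section \<open>Geometric tail of the stationary queue\<close>

lemma measure_bind_pmf:
  "measure_pmf.prob (bind_pmf p f) A = (\<integral>x. measure_pmf.prob (f x) A \<partial>p)"
  unfolding measure_pmf_bind
  by (subst measure_pmf.measure_bind[where N = "count_space UNIV"])
     (auto simp: space_subprob_algebra intro: prob_space_imp_subprob_space measure_pmf.prob_space_axioms)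

text \<open>Balance of the probability flow across the cut between j and j + 1.\<close>
lemma queue_stationary_pmf_Suc:
  assumes st: "queue_stationary la m p" and la: "0 \<le> la" "la \<le> 1" and m: "0 \<le> m" "m \<le> 1"
  shows "m * (1 - la) * pmf p (Suc j) = la * (1 - m) * pmf p j"
proof -
  define f where "f = (\<lambda>q::nat. bind_pmf (bernoulli_pmf la) (\<lambda>a.
           map_pmf (\<lambda>s. (q + of_bool a) - of_bool s) (bernoulli_pmf m)))"
  \<comment> \<open>The queue moves by at most 1, so one slot crosses the cut only from j upwards
    (arrival, no service) or from j + 1 downwards (service, no arrival).\<close>
  have f: "measure_pmf.prob (f q) {..j} =
      indicator {..j} q - la * (1 - m) * indicator {j} q + m * (1 - la) * indicator {Suc j} q" for q
  proof -
    have *: "measure_pmf.prob (map_pmf (\<lambda>s. (q + of_bool a) - of_bool s) (bernoulli_pmf m)) {..j} =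
       m * indicator {..j} (q + of_bool a - 1) + (1 - m) * indicator {..j} (q + of_bool a)" for a
      using m by (subst map_pmf_def, subst measure_bind_pmf) simp
    show ?thesis
      unfolding f_def measure_bind_pmf * using la m
      by (auto simp: indicator_def algebra_simps)
  qed
  have "measure_pmf.prob p {..j} = measure_pmf.prob (bind_pmf p f) {..j}"
    using st unfolding queue_stationary_def f_def by simp
  also have "\<dots> = (\<integral>q. measure_pmf.prob (f q) {..j} \<partial>p)"
    by (rule measure_bind_pmf)
  also have "\<dots> = measure_pmf.prob p {..j} - la * (1 - m) * measure_pmf.prob p {j}
                    + m * (1 - la) * measure_pmf.prob p {Suc j}"
    unfolding f by (simp add: measure_pmf.emeasure_eq_measure)
  finally show ?thesis by (simp add: measure_pmf_single)
qed

text \<open>The cut balance makes the stationary law geometric with ratio r, so shifting by q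
  multiplies all masses by r^q and the tail is exactly r^q. The ratio is at most 1 - (m - la), hence
  at most exp (- (m - la)).\<close>

lemma queue_stationary_tail:
  assumes st: "queue_stationary la m p" and la: "0 \<le> la" and m: "m \<le> 1" and lm: "la < m"
  shows "measure_pmf.prob p {q..} \<le> exp (- (m - la) * real q)"
proof -
  define r where "r = la * (1 - m) / (m * (1 - la))"
  have d: "m * (1 - la) > 0" using la m lm by auto
  have r0: "r \<ge> 0" using la m lm by (auto simp: r_def)
  have "1 - r = (m - la) / (m * (1 - la))"
    using d unfolding r_def by (subst diff_divide_eq_iff) (auto simp: algebra_simps)
  moreover have "(m - la) / (m * (1 - la)) \<ge> m - la"
  proof -
    have "m * (1 - la) \<le> 1" using la m lm by (simp add: mult_le_one)
    thus ?thesis using lm d by (simp add: le_divide_eq mult_left_le)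
  qed
  ultimately have r1: "r \<le> 1 - (m - la)" by simp
  have step: "pmf p (Suc j) = r * pmf p j" for j
    using queue_stationary_pmf_Suc[OF st, of j] la m lm d by (simp add: r_def field_simps)
  have sh: "pmf p (j + q) = r ^ q * pmf p j" for j
    by (induction q) (simp_all add: step)
  have "emeasure p {q..} = (\<integral>\<^sup>+j. ennreal (pmf p j) * indicator {q..} j \<partial>count_space UNIV)"
    by (subst nn_integral_indicator[symmetric]) (auto simp: nn_integral_measure_pmf)
  also have "\<dots> = (\<integral>\<^sup>+j. ennreal (pmf p j) \<partial>count_space {q..})"
    by (simp add: nn_integral_count_space_indicator)
  also have "\<dots> = (\<integral>\<^sup>+j. ennreal (pmf p (j + q)) \<partial>count_space UNIV)"
    by (rule nn_integral_bij_count_space[symmetric])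
       (auto intro!: bij_betwI[where g = "\<lambda>x. x - q"])
  also have "\<dots> = ennreal (r ^ q) * (\<integral>\<^sup>+j. ennreal (pmf p j) \<partial>count_space UNIV)"
    by (subst nn_integral_cmult[symmetric]) (auto simp: sh r0 ennreal_mult)
  also have "(\<integral>\<^sup>+j. ennreal (pmf p j) \<partial>count_space UNIV) = 1"
    by (simp add: nn_integral_pmf)
  finally have "measure_pmf.prob p {q..} = r ^ q"
    using r0 by (simp add: measure_pmf.emeasure_eq_measure)
  also have "r \<le> exp (- (m - la))"
    using r1 exp_ge_add_one_self[of "- (m - la)"] by linarith
  hence "r ^ q \<le> exp (- (m - la)) ^ q"
    using r0 by (intro power_mono)
  also have "\<dots> = exp (- (m - la) * real q)"
    by (simp add: exp_of_nat_mult[symmetric] mult.commute)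
  finally show ?thesis .
qed

section \<open>The system as a discrete Markov chain\<close>

definition beta_prod :: "nat \<Rightarrow> nat \<Rightarrow> qstate \<Rightarrow> (nat \<times> nat \<Rightarrow> real) measure" where
  "beta_prod U K s = PiM ({..<U} \<times> {..<K})
     (\<lambda>(u, k). beta_M (real (succ s u k) + 1) (real (fail s u k) + 1))"

lemma product_prob_space_beta:
  "product_prob_space (\<lambda>(u, k). beta_M (real (succ s u k) + 1) (real (fail s u k) + 1))"
  by (rule product_prob_spaceI) (auto simp: prob_space_beta_M)

lemma prob_space_beta_prod: "prob_space (beta_prod U K s)"
proof -
  interpret product_prob_space "\<lambda>(u, k). beta_M (real (succ s u k) + 1) (real (fail s u k) + 1)"
    "{..<U} \<times> {..<K}" by (rule product_prob_space_beta)
  show ?thesis unfolding beta_prod_def by (rule P.prob_space_axioms)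
qed

lemma measurable_beta_prod_component:
  assumes "u < U" "k < K"
  shows "(\<lambda>\<theta>. \<theta> (u, k)) \<in> borel_measurable (beta_prod U K s)"
proof -
  have "(\<lambda>\<theta>. \<theta> (u, k)) \<in> measurable (beta_prod U K s) (beta_M (real (succ s u k) + 1) (real (fail s u k) + 1))"
    using measurable_component_singleton[of "(u, k)" "{..<U} \<times> {..<K}"
      "\<lambda>(u, k). beta_M (real (succ s u k) + 1) (real (fail s u k) + 1)"] assms
    by (simp add: beta_prod_def)
  thus ?thesis by (simp add: sets_beta_M cong: measurable_cong_sets)
qed

lemma emeasure_beta_prod_component:
  assumes "u < U" "k < K" "B \<in> sets borel"
  shows "emeasure (beta_prod U K s) {\<theta> \<in> space (beta_prod U K s). \<theta> (u, k) \<in> B}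
         = emeasure (beta_M (real (succ s u k) + 1) (real (fail s u k) + 1)) B"
proof -
  interpret product_prob_space "\<lambda>(u, k). beta_M (real (succ s u k) + 1) (real (fail s u k) + 1)"
    "{..<U} \<times> {..<K}" by (rule product_prob_space_beta)
  show ?thesis
    unfolding beta_prod_def
    using emeasure_PiM_Collect_single[of "(u, k)" B] assms by (simp add: sets_beta_M)
qed

section \<open>The sampled choice as a discrete random variable\<close>

lemma khat_ex:
  fixes \<theta> :: "nat \<times> nat \<Rightarrow> real"
  assumes "K > 0"
  shows "\<exists>k. k < K \<and> (\<forall>j<K. \<theta> (u, j) \<le> \<theta> (u, k))"
proof -
  have "Max ((\<lambda>k. \<theta> (u, k)) ` {..<K}) \<in> (\<lambda>k. \<theta> (u, k)) ` {..<K}"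
    using assms by (intro Max_in) auto
  then obtain k where "k < K" "Max ((\<lambda>k. \<theta> (u, k)) ` {..<K}) = \<theta> (u, k)" by auto
  moreover have "\<theta> (u, j) \<le> Max ((\<lambda>k. \<theta> (u, k)) ` {..<K})" if "j < K" for j
    using that by (intro Max_ge) auto
  ultimately show ?thesis by auto
qed

lemma khat_props:
  assumes "K > 0"
  shows "khat K \<theta> u < K" "j < K \<Longrightarrow> \<theta> (u, j) \<le> \<theta> (u, khat K \<theta> u)"
  using LeastI_ex[OF khat_ex[OF assms, of \<theta> u]] by (auto simp: khat_def)

text \<open>Resolves \<open>LEAST\<close> into finitely many comparisons of coordinates, from which
  measurability can be read off.\<close>

lemma khat_eq_iff:
  assumes "K > 0"
  shows "khat K \<theta> u = k \<longleftrightarrow> k < K \<and> (\<forall>j<K. \<theta> (u, j) \<le> \<theta> (u, k)) \<and>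
    (\<forall>i<k. \<not> (\<forall>j<K. \<theta> (u, j) \<le> \<theta> (u, i)))"
proof
  assume "khat K \<theta> u = k"
  thus "k < K \<and> (\<forall>j<K. \<theta> (u, j) \<le> \<theta> (u, k)) \<and> (\<forall>i<k. \<not> (\<forall>j<K. \<theta> (u, j) \<le> \<theta> (u, i)))"
    using khat_props[OF assms, where \<theta> = \<theta> and u = u] not_less_Least[of _ "\<lambda>k. k < K \<and> (\<forall>j<K. \<theta> (u, j) \<le> \<theta> (u, k))"]
    by (auto simp: khat_def dest: less_trans)
next
  assume "k < K \<and> (\<forall>j<K. \<theta> (u, j) \<le> \<theta> (u, k)) \<and> (\<forall>i<k. \<not> (\<forall>j<K. \<theta> (u, j) \<le> \<theta> (u, i)))"
  thus "khat K \<theta> u = k"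
    unfolding khat_def by (intro Least_equality) (auto simp: not_less[symmetric])
qed

text \<open>Fixing the value 0 outside the queues makes the set finite. \<open>khat\<close> respects
  this: a point of the product space is \<open>undefined\<close> off the index set, so there all
  servers tie and the least one is 0.\<close>

definition khat_range :: "nat \<Rightarrow> nat \<Rightarrow> (nat \<Rightarrow> nat) set" where
  "khat_range U K = {f. (\<forall>u<U. f u < K) \<and> (\<forall>u\<ge>U. f u = 0)}"

lemma finite_khat_range: "finite (khat_range U K)"
proof (rule finite_subset)
  show "khat_range U K \<subseteq> {f. \<forall>u. (u \<in> {..<U} \<longrightarrow> f u \<in> {..<K}) \<and> (u \<notin> {..<U} \<longrightarrow> f u = 0)}"
    by (auto simp: khat_range_def)
  show "finite {f. \<forall>u. (u \<in> {..<U} \<longrightarrow> f u \<in> {..<K}) \<and> (u \<notin> {..<U} \<longrightarrow> f u = 0)}"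
    by (rule finite_set_of_finite_funs) auto
qed

lemma khat_in_range:
  assumes "K > 0" "\<theta> \<in> space (beta_prod U K s)"
  shows "khat K \<theta> \<in> khat_range U K"
proof -
  have "khat K \<theta> u = 0" if "u \<ge> U" for u
  proof -
    have "\<theta> (u, k) = undefined" for k
      using assms(2) that by (auto simp: beta_prod_def space_PiM PiE_def extensional_def)
    thus ?thesis using assms(1) by (subst khat_eq_iff) auto
  qed
  thus ?thesis using khat_props(1)[OF assms(1)] by (auto simp: khat_range_def)
qed

lemma measurable_khat:
  assumes K: "K > 0"
  shows "khat K \<in> measurable (beta_prod U K s) (count_space UNIV)"
proof -
  let ?M = "beta_prod U K s"
  have single: "{\<theta> \<in> space ?M. khat K \<theta> = a} \<in> sets ?M" if a: "a \<in> khat_range U K" for a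
  proof -
    have m: "{\<theta> \<in> space ?M. khat K \<theta> u = a u} \<in> sets ?M" if u: "u < U" for u
    proof -
      have au: "a u < K" using a u by (auto simp: khat_range_def)
      have le: "{\<theta> \<in> space ?M. \<theta> (u, j) \<le> \<theta> (u, i)} \<in> sets ?M" if "i < K" "j < K" for i j
        using that u by (intro borel_measurable_le measurable_beta_prod_component)
      have all: "{\<theta> \<in> space ?M. \<forall>j\<in>{..<K}. \<theta> (u, j) \<le> \<theta> (u, i)} \<in> sets ?M" if "i < K" for i
        by (intro sets.sets_Collect_finite_All le) (use that in auto)
      have "{\<theta> \<in> space ?M. (\<forall>j\<in>{..<K}. \<theta> (u, j) \<le> \<theta> (u, a u)) \<and>
          (\<forall>i\<in>{..<a u}. \<not> (\<forall>j\<in>{..<K}. \<theta> (u, j) \<le> \<theta> (u, i)))} \<in> sets ?M"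
        by (intro sets.sets_Collect_conj sets.sets_Collect_finite_All sets.sets_Collect_neg all)
           (use au in auto)
      also have "{\<theta> \<in> space ?M. (\<forall>j\<in>{..<K}. \<theta> (u, j) \<le> \<theta> (u, a u)) \<and>
          (\<forall>i\<in>{..<a u}. \<not> (\<forall>j\<in>{..<K}. \<theta> (u, j) \<le> \<theta> (u, i)))} =
        {\<theta> \<in> space ?M. khat K \<theta> u = a u}"
        unfolding khat_eq_iff[OF K] using au by (simp add: Ball_def)
      finally show ?thesis .
    qed
    have eq: "khat K \<theta> = a \<longleftrightarrow> (\<forall>u\<in>{..<U}. khat K \<theta> u = a u)" if "\<theta> \<in> space ?M" for \<theta>
    proof
      assume *: "\<forall>u\<in>{..<U}. khat K \<theta> u = a u"
      show "khat K \<theta> = a"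
      proof
        fix u show "khat K \<theta> u = a u"
          using * a khat_in_range[OF K that] by (cases "u < U") (simp_all add: khat_range_def)
      qed
    qed auto
    have "{\<theta> \<in> space ?M. khat K \<theta> = a} = {\<theta> \<in> space ?M. \<forall>u\<in>{..<U}. khat K \<theta> u = a u}"
      using eq by blast
    also have "\<dots> \<in> sets ?M"
      by (intro sets.sets_Collect_finite_All m) auto
    finally show ?thesis .
  qed
  show ?thesis
  proof (rule measurableI)
    fix A :: "(nat \<Rightarrow> nat) set"
    have "khat K -` A \<inter> space ?M = (\<Union>a\<in>A \<inter> khat_range U K. {\<theta> \<in> space ?M. khat K \<theta> = a})"
      using khat_in_range[OF K] by auto
    also have "\<dots> \<in> sets ?M"
      using single finite_khat_range by (intro sets.finite_UN) auto
    finally show "khat K -` A \<inter> space ?M \<in> sets ?M" .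
  qed auto
qed

text \<open>The Beta samples influence the system only through the finitely many values of
  \<open>khat\<close>. Trading their law for a pmf makes the whole chain discrete, so that later
  integrals can be exchanged without measurability conditions.\<close>

definition khat_pmf :: "nat \<Rightarrow> nat \<Rightarrow> qstate \<Rightarrow> (nat \<Rightarrow> nat) pmf" where
  "khat_pmf U K s = Abs_pmf (distr (beta_prod U K s) (count_space UNIV) (khat K))"

lemma measure_pmf_khat_pmf:
  assumes K: "K > 0"
  shows "measure_pmf (khat_pmf U K s) = distr (beta_prod U K s) (count_space UNIV) (khat K)"
proof -
  let ?D = "distr (beta_prod U K s) (count_space UNIV) (khat K)"
  note [measurable] = measurable_khat[OF K]
  interpret B: prob_space "beta_prod U K s" by (rule prob_space_beta_prod)
  interpret D: prob_space ?D by (rule B.prob_space_distr) measurable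
  have "AE x in ?D. x \<in> khat_range U K"
    by (subst AE_distr_iff) (auto simp: khat_in_range[OF K])
  \<comment> \<open>A pmf must charge almost every point. Values of mass 0 form a finite union of
    null sets, hence a null set.\<close>
  moreover have "AE x in ?D. x \<notin> {a \<in> khat_range U K. measure ?D {a} = 0}"
  proof (rule AE_not_in)
    have "(\<Union>a\<in>{a \<in> khat_range U K. measure ?D {a} = 0}. {a}) \<in> null_sets ?D"
      by (intro null_sets_UN' countable_finite)
         (auto simp: finite_khat_range D.emeasure_eq_measure null_sets_def)
    thus "{a \<in> khat_range U K. measure ?D {a} = 0} \<in> null_sets ?D" by simp
  qed
  ultimately have "AE x in ?D. measure ?D {x} \<noteq> 0"
    by eventually_elim auto
  thus ?thesis
    unfolding khat_pmf_def by (intro Abs_pmf_inverse) (auto simp: D.prob_space_axioms)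
qed

lemma set_khat_pmf:
  assumes K: "K > 0"
  shows "set_pmf (khat_pmf U K s) \<subseteq> khat_range U K"
proof -
  have "AE x in measure_pmf (khat_pmf U K s). x \<in> khat_range U K"
    unfolding measure_pmf_khat_pmf[OF K]
    by (subst AE_distr_iff) (auto simp: khat_in_range[OF K] measurable_khat[OF K])
  thus ?thesis by (auto simp: AE_measure_pmf_iff)
qed

lemma beta_prod_bind_return:
  assumes K: "K > 0"
  shows "beta_prod U K s \<bind> (\<lambda>\<theta>. return (count_space UNIV) (g (khat K \<theta>)))
         = measure_pmf (map_pmf g (khat_pmf U K s))"
proof -
  note [measurable] = measurable_khat[OF K]
  interpret B: prob_space "beta_prod U K s" by (rule prob_space_beta_prod)
  have "beta_prod U K s \<bind> (\<lambda>\<theta>. return (count_space UNIV) (g (khat K \<theta>)))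
      = distr (beta_prod U K s) (count_space UNIV) (\<lambda>\<theta>. g (khat K \<theta>))"
    by (rule bind_return_distr') (auto simp: B.not_empty intro: measurable_compose[OF measurable_khat[OF K]])
  also have "\<dots> = distr (distr (beta_prod U K s) (count_space UNIV) (khat K)) (count_space UNIV) g"
    by (subst distr_distr) (auto simp: o_def)
  finally show ?thesis
    by (simp add: map_pmf_rep_eq measure_pmf_khat_pmf[OF K])
qed

section \<open>The system with the recorded history of one queue\<close>

locale queueing_bandit =
  fixes U K :: nat and lam :: "nat \<Rightarrow> real" and mu :: "nat \<Rightarrow> nat \<Rightarrow> real"
    and Em :: "nat \<Rightarrow> nat \<Rightarrow> nat option"
    and sel :: "nat \<Rightarrow> qstate \<Rightarrow> (nat \<Rightarrow> nat) \<Rightarrow> nat \<Rightarrow> nat option"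
    and st :: "nat \<Rightarrow> nat pmf"
  assumes U_pos: "1 \<le> U" and U_le_K: "U \<le> K"
    and lam_range: "u < U \<Longrightarrow> 0 \<le> lam u \<and> lam u \<le> 1"
    and mu_range: "u < U \<Longrightarrow> k < K \<Longrightarrow> 0 \<le> mu u k \<and> mu u k \<le> 1"
    and unique_best: "u < U \<Longrightarrow> \<exists>!k. k < K \<and> mu u k = mustar K mu u"
    and kstar_inj: "inj_on (kstar K mu) {..<U}"
    and eps_pos: "u < U \<Longrightarrow> epsq K lam mu u > 0"
    and Em_cover: "u < U \<Longrightarrow> k < K \<Longrightarrow> \<exists>i<K. Em i u = Some k"
    and sel_optimal: "(\<And>u. u < U \<Longrightarrow> kh u < K) \<Longrightarrow> is_matching U K \<kappa> \<Longrightarrow>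
        mismatch U (sel t s kh) kh \<le> mismatch U \<kappa> kh"
    and stationary: "u < U \<Longrightarrow> queue_stationary (lam u) (mustar K mu u) (st u)"
begin

abbreviation ks :: "nat \<Rightarrow> nat" where "ks \<equiv> kstar K mu"

lemma K_pos: "K > 0"
  using U_pos U_le_K by simp

lemma ks_props:
  assumes "u < U"
  shows "ks u < K" "mu u (ks u) = mustar K mu u" "k < K \<Longrightarrow> mu u k = mustar K mu u \<Longrightarrow> k = ks u"
  using theI'[OF unique_best[OF assms]] unique_best[OF assms] by (auto simp: kstar_def)

text \<open>Because the best servers are distinct, assigning each queue its best server is a
  matching. Its mismatch with \<open>kh\<close> is 0, so every minimiser has mismatch 0 as well and
  must agree with it on the queues.\<close>

lemma sel_correct:
  assumes kh: "\<And>u. u < U \<Longrightarrow> kh u = ks u" and u: "u < U"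
  shows "sel t s kh u = Some (ks u)"
proof -
  define \<kappa> where "\<kappa> = (\<lambda>u. if u < U then Some (ks u) else None)"
  have "is_matching U K \<kappa>"
    using kstar_inj ks_props(1) by (auto simp: is_matching_def \<kappa>_def inj_on_def split: if_splits)
  hence "mismatch U (sel t s kh) kh \<le> mismatch U \<kappa> kh"
    using kh ks_props(1) by (intro sel_optimal) auto
  also have "\<dots> = 0" using kh by (auto simp: mismatch_def \<kappa>_def)
  finally have "{u \<in> {..<U}. sel t s kh u \<noteq> Some (kh u)} = {}"
    by (simp add: mismatch_def)
  thus ?thesis using u kh by auto
qed

definition arrivals :: "(nat \<Rightarrow> bool) pmf" where
  "arrivals = Pi_pmf {..<U} False (\<lambda>u. bernoulli_pmf (lam u))"

definition services :: "(nat \<times> nat \<Rightarrow> bool) pmf" where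
  "services = Pi_pmf ({..<U} \<times> {..<K}) False (\<lambda>(u, k). bernoulli_pmf (mu u k))"

text \<open>The coin is kept beside the matching since the two causes of a bad slot, exploration and
  error, are told apart by it.\<close>

definition decision :: "nat \<Rightarrow> qstate \<Rightarrow> (bool \<times> (nat \<Rightarrow> nat option)) pmf" where
  "decision t s = bernoulli_pmf (explore_prob K t) \<bind> (\<lambda>e.
     if e then map_pmf (\<lambda>i. (True, Em i)) (pmf_of_set {..<K})
     else map_pmf (\<lambda>kh. (False, sel t s kh)) (khat_pmf U K s))"

lemma qths_step_eq:
  "qths_step U K lam mu Em sel t s = measure_pmf (arrivals \<bind> (\<lambda>A. services \<bind> (\<lambda>R.
     map_pmf (\<lambda>c. qupd U ks s (snd c) A R) (decision t s))))"
proof -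
  have 1: "measure_pmf (pmf_of_set {..<K}) \<bind> (\<lambda>i. return (count_space UNIV) (qupd U ks s (Em i) A R))
      = measure_pmf (map_pmf (\<lambda>i. qupd U ks s (Em i) A R) (pmf_of_set {..<K}))" for A R
    by (simp add: map_pmf_def measure_pmf_bind return_pmf.rep_eq)
  have 2: "PiM ({..<U} \<times> {..<K})
             (\<lambda>(u, k). beta_M (real (succ s u k) + 1) (real (fail s u k) + 1)) \<bind> (\<lambda>\<theta>.
           return (count_space UNIV) (qupd U ks s (sel t s (khat K \<theta>)) A R))
      = measure_pmf (map_pmf (\<lambda>kh. qupd U ks s (sel t s kh) A R) (khat_pmf U K s))" for A R
    using beta_prod_bind_return[OF K_pos, of U s "\<lambda>kh. qupd U ks s (sel t s kh) A R"]
    by (simp add: beta_prod_def)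
  have 3: "(if e then measure_pmf p else measure_pmf q) = measure_pmf (if e then p else q)"
    for e and p q :: "qstate pmf" by simp
  have 4: "map_pmf (\<lambda>c. qupd U ks s (snd c) A R) (decision t s) =
     bernoulli_pmf (explore_prob K t) \<bind> (\<lambda>e. if e
       then map_pmf (\<lambda>i. qupd U ks s (Em i) A R) (pmf_of_set {..<K})
       else map_pmf (\<lambda>kh. qupd U ks s (sel t s kh) A R) (khat_pmf U K s))" for A R
    unfolding decision_def map_bind_pmf
    by (intro bind_pmf_cong) (auto simp: pmf.map_comp o_def)
  show ?thesis
    unfolding qths_step_def 1 2 3 4 measure_pmf_bind arrivals_def services_def ..
qed

end

text \<open>The state of the system together with the history of one fixed queue: its initial length
  and, for every slot, arrival minus genie service, whether the slot explored, and whether it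
  exploited without assigning the best server.\<close>
record history =
  cur :: qstate
  init_len :: nat
  drift :: "nat \<Rightarrow> int"
  explored :: "nat \<Rightarrow> bool"
  erred :: "nat \<Rightarrow> bool"

context queueing_bandit
begin

definition next_history :: "nat \<Rightarrow> nat \<Rightarrow> history \<Rightarrow> (nat \<Rightarrow> bool) \<Rightarrow> (nat \<times> nat \<Rightarrow> bool)
    \<Rightarrow> bool \<times> (nat \<Rightarrow> nat option) \<Rightarrow> history" where
  "next_history u t x A R c =
     \<lparr> cur = qupd U ks (cur x) (snd c) A R,
       init_len = init_len x,
       drift = (drift x)(t := of_bool (A u) - of_bool (R (u, ks u))),
       explored = (explored x)(t := fst c),
       erred = (erred x)(t := (\<not> fst c \<and> snd c u \<noteq> Some (ks u))) \<rparr>"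

primrec hist :: "nat \<Rightarrow> nat \<Rightarrow> history pmf" where
  "hist u 0 = map_pmf (\<lambda>q. \<lparr> cur = \<lparr> succ = (\<lambda>_ _. 0), fail = (\<lambda>_ _. 0), Qa = q, Qg = q \<rparr>,
       init_len = q u, drift = (\<lambda>_. 0), explored = (\<lambda>_. False), erred = (\<lambda>_. False) \<rparr>)
     (Pi_pmf {..<U} 0 st)"
| "hist u (Suc t) = hist u t \<bind> (\<lambda>x. arrivals \<bind> (\<lambda>A. services \<bind> (\<lambda>R.
     map_pmf (next_history u (Suc t) x A R) (decision (Suc t) (cur x)))))"

text \<open>The state evolves without reading the records, so its law is the same whichever queue
  \<open>u\<close> is tracked.\<close>

lemma qths_law_eq: "qths_law U K lam mu Em sel st t = measure_pmf (map_pmf cur (hist u t))"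
proof (induction t)
  case 0
  show ?case
    by (simp add: map_pmf_def measure_pmf_bind return_pmf.rep_eq bind_assoc_pmf bind_return_pmf)
next
  case (Suc t)
  have "map_pmf cur (hist u (Suc t)) = map_pmf cur (hist u t) \<bind> (\<lambda>s. arrivals \<bind> (\<lambda>A. services \<bind> (\<lambda>R.
     map_pmf (\<lambda>c. qupd U ks s (snd c) A R) (decision (Suc t) s))))"
    by (simp add: map_bind_pmf bind_map_pmf pmf.map_comp o_def next_history_def)
  thus ?case
    using Suc by (simp add: measure_pmf_bind qths_step_eq[abs_def] del: hist.simps)
qed

lemma regret_eq: "regret U K lam mu Em sel st u' t = (\<integral>x. real (Qa (cur x) u') - real (Qg (cur x) u') \<partial>hist u t)"
  unfolding regret_def qths_law_eq[of t u] by simp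

end

section \<open>Exponential moments of the slots\<close>

lemma nn_integral_pmf_commute:
  "(\<integral>\<^sup>+x. \<integral>\<^sup>+y. f x y \<partial>measure_pmf B \<partial>measure_pmf A) = (\<integral>\<^sup>+y. \<integral>\<^sup>+x. f x y \<partial>measure_pmf A \<partial>measure_pmf B)"
proof -
  have "(\<integral>\<^sup>+z. f (fst z) (snd z) \<partial>bind_pmf A (\<lambda>x. bind_pmf B (\<lambda>y. return_pmf (x, y)))) =
        (\<integral>\<^sup>+z. f (fst z) (snd z) \<partial>bind_pmf B (\<lambda>y. bind_pmf A (\<lambda>x. return_pmf (x, y))))"
    by (subst bind_commute_pmf) simp
  thus ?thesis by simp
qed

lemma explore_prob_range: "0 \<le> explore_prob K t" "explore_prob K t \<le> 1"
  by (auto simp: explore_prob_def)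

context queueing_bandit
begin

text \<open>Given the state, decision, services and arrivals are independent. The decision is put
  outermost, so that arrivals and services are averaged for a fixed matching.\<close>

lemma nn_integral_hist_Suc:
  "(\<integral>\<^sup>+x. F x \<partial>hist u (Suc t)) = (\<integral>\<^sup>+x. \<integral>\<^sup>+c. \<integral>\<^sup>+R. \<integral>\<^sup>+A. F (next_history u (Suc t) x A R c)
     \<partial>arrivals \<partial>services \<partial>decision (Suc t) (cur x) \<partial>hist u t)"
proof -
  have "(\<integral>\<^sup>+A. \<integral>\<^sup>+R. \<integral>\<^sup>+c. F (next_history u (Suc t) x A R c) \<partial>D \<partial>services \<partial>arrivals) =
        (\<integral>\<^sup>+c. \<integral>\<^sup>+R. \<integral>\<^sup>+A. F (next_history u (Suc t) x A R c) \<partial>arrivals \<partial>services \<partial>D)"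
    for x and D :: "(bool \<times> (nat \<Rightarrow> nat option)) pmf"
    by (subst nn_integral_pmf_commute, subst (2) nn_integral_pmf_commute, subst nn_integral_pmf_commute) (rule refl)
  thus ?thesis by simp
qed

lemma nn_integral_arrivals:
  assumes "u < U"
  shows "(\<integral>\<^sup>+A. g (A u) \<partial>arrivals) = g True * ennreal (lam u) + g False * ennreal (1 - lam u)"
proof -
  have "(\<integral>\<^sup>+A. g (A u) \<partial>arrivals) = (\<integral>\<^sup>+a. g a \<partial>map_pmf (\<lambda>A. A u) arrivals)" by simp
  also have "map_pmf (\<lambda>A. A u) arrivals = bernoulli_pmf (lam u)"
    unfolding arrivals_def using assms by (subst Pi_pmf_component) auto
  finally show ?thesis using lam_range[OF assms] by simp
qed

lemma nn_integral_services:
  assumes "u < U" "k < K"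
  shows "(\<integral>\<^sup>+R. g (R (u, k)) \<partial>services) = g True * ennreal (mu u k) + g False * ennreal (1 - mu u k)"
proof -
  have "(\<integral>\<^sup>+R. g (R (u, k)) \<partial>services) = (\<integral>\<^sup>+a. g a \<partial>map_pmf (\<lambda>R. R (u, k)) services)" by simp
  also have "map_pmf (\<lambda>R. R (u, k)) services = bernoulli_pmf (mu u k)"
    unfolding services_def using assms by (subst Pi_pmf_component) auto
  finally show ?thesis using mu_range[OF assms] by simp
qed

lemma nn_integral_decision:
  "(\<integral>\<^sup>+c. g c \<partial>decision t s) =
     (\<integral>\<^sup>+i. g (True, Em i) \<partial>pmf_of_set {..<K}) * ennreal (explore_prob K t)
     + (\<integral>\<^sup>+kh. g (False, sel t s kh) \<partial>khat_pmf U K s) * ennreal (1 - explore_prob K t)"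
  unfolding decision_def using explore_prob_range[of K t] by simp

lemma nn_integral_decision_fst:
  "(\<integral>\<^sup>+c. g (fst c) \<partial>decision t s) =
     g True * ennreal (explore_prob K t) + g False * ennreal (1 - explore_prob K t)"
  by (subst nn_integral_decision) (simp add: measure_pmf.emeasure_space_1)

lemma bernoulli_mgf_ennreal:
  assumes "0 \<le> p" "p \<le> 1"
  shows "ennreal (exp (h * 1 + b)) * ennreal p + ennreal (exp (h * 0 + b)) * ennreal (1 - p)
          \<le> ennreal (exp (h * p + h\<^sup>2 / 8 + b))"
proof -
  have "ennreal (exp (h * 1 + b)) * ennreal p + ennreal (exp (h * 0 + b)) * ennreal (1 - p)
     = ennreal (exp b * ((1 - p) + p * exp h))"
    using assms by (simp flip: ennreal_mult' ennreal_plus add: exp_add algebra_simps)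
  also have "\<dots> \<le> ennreal (exp b * exp (h * p + h\<^sup>2 / 8))"
    by (intro ennreal_leI mult_left_mono bernoulli_mgf_le assms) auto
  finally show ?thesis by (simp add: exp_add mult_ac)
qed

text \<open>Arrival and genie service each cost \<theta>^2 / 8 by Hoeffding's lemma and together
  have mean -e, where e is the slack. The coin uses exp \<theta> <= 1 + 2 \<theta> on [0, 1]
  instead, which keeps its contribution proportional to the small exploration probability.\<close>

lemma slot_mgf_le:
  assumes u: "u < U" and th: "0 \<le> \<theta>" "\<theta> \<le> 1"
  shows "(\<integral>\<^sup>+c. \<integral>\<^sup>+R. \<integral>\<^sup>+A. ennreal (exp (\<theta> * (of_int (of_bool (A u) - of_bool (R (u, ks u))) + of_bool (fst c))))
      \<partial>arrivals \<partial>services \<partial>decision t s)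
    \<le> ennreal (exp (- \<theta> * epsq K lam mu u + \<theta>\<^sup>2 / 4 + 2 * \<theta> * explore_prob K t))"
proof -
  note k = ks_props[OF u]
  let ?p = "explore_prob K t"
  have A: "(\<integral>\<^sup>+A. ennreal (exp (\<theta> * (of_int (of_bool (A u) - of_bool r) + of_bool e))) \<partial>arrivals)
      \<le> ennreal (exp ((-\<theta>) * of_bool r + (\<theta> * lam u + \<theta>\<^sup>2 / 8 + \<theta> * of_bool e)))" for r e
    using bernoulli_mgf_ennreal[of "lam u" \<theta> "\<theta> * of_bool e - \<theta> * of_bool r"] lam_range[OF u]
    by (subst nn_integral_arrivals[OF u, of "\<lambda>a. ennreal (exp (\<theta> * (of_int (of_bool a - of_bool r) + of_bool e)))"])
       (simp add: algebra_simps)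
  have R: "(\<integral>\<^sup>+R. ennreal (exp ((-\<theta>) * of_bool (R (u, ks u)) + (\<theta> * lam u + \<theta>\<^sup>2 / 8 + \<theta> * of_bool e))) \<partial>services)
      \<le> ennreal (exp (- \<theta> * epsq K lam mu u + \<theta>\<^sup>2 / 4 + \<theta> * of_bool e))" for e
    using bernoulli_mgf_ennreal[of "mu u (ks u)" "-\<theta>" "\<theta> * lam u + \<theta>\<^sup>2 / 8 + \<theta> * of_bool e"] mu_range[OF u k(1)]
    by (subst nn_integral_services[OF u k(1), of "\<lambda>a. ennreal (exp ((-\<theta>) * of_bool a + (\<theta> * lam u + \<theta>\<^sup>2 / 8 + \<theta> * of_bool e)))"])
       (simp add: algebra_simps epsq_def k(2))
  have C: "(\<integral>\<^sup>+c. ennreal (exp (- \<theta> * epsq K lam mu u + \<theta>\<^sup>2 / 4 + \<theta> * of_bool (fst c))) \<partial>decision t s)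
      \<le> ennreal (exp (- \<theta> * epsq K lam mu u + \<theta>\<^sup>2 / 4 + 2 * \<theta> * ?p))"
  proof -
    let ?a = "- \<theta> * epsq K lam mu u + \<theta>\<^sup>2 / 4"
    have aux: "ennreal (exp (a + \<theta>)) * ennreal q + ennreal (exp a) * ennreal (1 - q)
        = ennreal (exp a * (q * exp \<theta> + (1 - q)))" if "0 \<le> q" "q \<le> 1" for a q
      using that by (simp flip: ennreal_mult' ennreal_plus add: exp_add algebra_simps)
    have "exp \<theta> \<le> 1 + 2 * \<theta>"
    proof -
      have "exp \<theta> \<le> 1 + \<theta> + \<theta>\<^sup>2" using th by (intro exp_bound) auto
      moreover have "\<theta>\<^sup>2 \<le> \<theta>" using th by (simp add: power2_eq_square mult_left_le)
      ultimately show ?thesis by linarith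
    qed
    hence "?p * exp \<theta> \<le> ?p * (1 + 2 * \<theta>)" by (intro mult_left_mono explore_prob_range)
    hence "?p * exp \<theta> + (1 - ?p) \<le> 1 + 2 * \<theta> * ?p" by (simp add: algebra_simps)
    also have "\<dots> \<le> exp (2 * \<theta> * ?p)" by simp
    finally have *: "?p * exp \<theta> + (1 - ?p) \<le> exp (2 * \<theta> * ?p)" .
    have "(\<integral>\<^sup>+c. ennreal (exp (?a + \<theta> * of_bool (fst c))) \<partial>decision t s)
       = ennreal (exp (?a + \<theta>)) * ennreal ?p + ennreal (exp ?a) * ennreal (1 - ?p)"
      by (subst nn_integral_decision_fst[where g = "\<lambda>e. ennreal (exp (?a + \<theta> * of_bool e))"]) simp
    also have "\<dots> = ennreal (exp ?a * (?p * exp \<theta> + (1 - ?p)))"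
      by (rule aux) (rule explore_prob_range)+
    also have "\<dots> \<le> ennreal (exp ?a * exp (2 * \<theta> * ?p))"
      by (intro ennreal_leI mult_left_mono *) auto
    finally show ?thesis by (simp only: exp_add)
  qed
  have "(\<integral>\<^sup>+c. \<integral>\<^sup>+R. \<integral>\<^sup>+A. ennreal (exp (\<theta> * (of_int (of_bool (A u) - of_bool (R (u, ks u))) + of_bool (fst c))))
      \<partial>arrivals \<partial>services \<partial>decision t s)
    \<le> (\<integral>\<^sup>+c. \<integral>\<^sup>+R. ennreal (exp ((-\<theta>) * of_bool (R (u, ks u)) + (\<theta> * lam u + \<theta>\<^sup>2 / 8 + \<theta> * of_bool (fst c))))
      \<partial>services \<partial>decision t s)"
    by (intro nn_integral_mono A)
  also have "\<dots> \<le> (\<integral>\<^sup>+c. ennreal (exp (- \<theta> * epsq K lam mu u + \<theta>\<^sup>2 / 4 + \<theta> * of_bool (fst c))) \<partial>decision t s)"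
    by (intro nn_integral_mono R)
  also note C
  finally show ?thesis .
qed

text \<open>Exploitation errors are left out on purpose: with the coin alone the one-slot
  exponential moment has a bound uniform in the state.\<close>

definition load :: "history \<Rightarrow> nat \<Rightarrow> nat \<Rightarrow> real" where
  "load x r t = (\<Sum>l\<in>{r<..t}. of_int (drift x l) + of_bool (explored x l))"

lemma load_next_history:
  assumes "r \<le> t"
  shows "load (next_history u (Suc t) x A R c) r (Suc t) =
     load x r t + (of_int (of_bool (A u) - of_bool (R (u, ks u))) + of_bool (fst c))"
proof -
  have "{r<..Suc t} = insert (Suc t) {r<..t}" using assms by auto
  hence "load (next_history u (Suc t) x A R c) r (Suc t) =
    (of_int (of_bool (A u) - of_bool (R (u, ks u))) + of_bool (fst c)) +
    (\<Sum>l\<in>{r<..t}. of_int (drift (next_history u (Suc t) x A R c) l) + of_bool (explored (next_history u (Suc t) x A R c) l))"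
    unfolding load_def by (simp add: next_history_def)
  also have "(\<Sum>l\<in>{r<..t}. of_int (drift (next_history u (Suc t) x A R c) l) + of_bool (explored (next_history u (Suc t) x A R c) l))
     = load x r t"
    unfolding load_def by (intro sum.cong) (auto simp: next_history_def)
  finally show ?thesis by simp
qed

text \<open>The one-slot bound holds for every state, so conditioning on the past slot by slot
  multiplies the factors.\<close>

lemma load_mgf_le:
  assumes u: "u < U" and th: "0 \<le> \<theta>" "\<theta> \<le> 1" and rt: "r \<le> t"
  shows "(\<integral>\<^sup>+x. ennreal (exp (\<theta> * load x r t)) \<partial>hist u t)
     \<le> ennreal (exp (real (t - r) * (- \<theta> * epsq K lam mu u + \<theta>\<^sup>2 / 4) + 2 * \<theta> * (\<Sum>l\<in>{r<..t}. explore_prob K l)))"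
  using rt
proof (induction t rule: dec_induct)
  case base
  show ?case by (simp add: load_def measure_pmf.emeasure_space_1)
next
  case (step t)
  let ?a = "- \<theta> * epsq K lam mu u + \<theta>\<^sup>2 / 4"
  have *: "{r<..Suc t} = insert (Suc t) {r<..t}" using step by auto
  have e: "ennreal (exp (\<theta> * load (next_history u (Suc t) x A R c) r (Suc t))) = ennreal (exp (\<theta> * load x r t)) *
      ennreal (exp (\<theta> * (of_int (of_bool (A u) - of_bool (R (u, ks u))) + of_bool (fst c))))" for x A R c
    by (simp only: load_next_history[OF step(1)] distrib_left[of \<theta> "load x r t"] exp_add)
       (simp add: ennreal_mult)
  have "(\<integral>\<^sup>+x. ennreal (exp (\<theta> * load x r (Suc t))) \<partial>hist u (Suc t))
     = (\<integral>\<^sup>+x. ennreal (exp (\<theta> * load x r t)) * (\<integral>\<^sup>+c. \<integral>\<^sup>+R. \<integral>\<^sup>+A. ennreal (exp (\<theta> * (of_int (of_bool (A u) - of_bool (R (u, ks u))) + of_bool (fst c))))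
         \<partial>arrivals \<partial>services \<partial>decision (Suc t) (cur x)) \<partial>hist u t)"
    unfolding nn_integral_hist_Suc e by (simp add: nn_integral_cmult)
  also have "\<dots> \<le> (\<integral>\<^sup>+x. ennreal (exp (\<theta> * load x r t)) * ennreal (exp (?a + 2 * \<theta> * explore_prob K (Suc t))) \<partial>hist u t)"
    by (intro nn_integral_mono mult_left_mono slot_mgf_le u th) auto
  also have "\<dots> = (\<integral>\<^sup>+x. ennreal (exp (\<theta> * load x r t)) \<partial>hist u t) * ennreal (exp (?a + 2 * \<theta> * explore_prob K (Suc t)))"
    by (simp add: nn_integral_multc)
  also have "\<dots> \<le> ennreal (exp (real (t - r) * ?a + 2 * \<theta> * (\<Sum>l\<in>{r<..t}. explore_prob K l)))
        * ennreal (exp (?a + 2 * \<theta> * explore_prob K (Suc t)))"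
    by (intro mult_right_mono step.IH) auto
  also have "\<dots> = ennreal (exp ((real (t - r) * ?a + 2 * \<theta> * (\<Sum>l\<in>{r<..t}. explore_prob K l)) + (?a + 2 * \<theta> * explore_prob K (Suc t))))"
    by (simp add: exp_add ennreal_mult)
  also have "(real (t - r) * ?a + 2 * \<theta> * (\<Sum>l\<in>{r<..t}. explore_prob K l)) + (?a + 2 * \<theta> * explore_prob K (Suc t))
     = real (Suc t - r) * ?a + 2 * \<theta> * (\<Sum>l\<in>{r<..Suc t}. explore_prob K l)"
  proof -
    have "real (Suc t - r) = real (t - r) + 1" using step(1) by (simp add: Suc_diff_le)
    moreover have "(\<Sum>l\<in>{r<..Suc t}. explore_prob K l) = explore_prob K (Suc t) + (\<Sum>l\<in>{r<..t}. explore_prob K l)"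
      unfolding * by simp
    ultimately show ?thesis by algebra
  qed
  finally show ?case .
qed

text \<open>A recorded value never changes afterwards, so its law may be computed at the slot that
  records it.\<close>

lemma map_hist_const:
  assumes "m \<le> t" and "\<And>l x A R c. m \<le> l \<Longrightarrow> F (next_history u (Suc l) x A R c) = F x"
  shows "map_pmf F (hist u t) = map_pmf F (hist u m)"
  using assms(1)
proof (induction t rule: dec_induct)
  case (step t)
  have "map_pmf F (hist u (Suc t)) = map_pmf F (hist u t)"
    using assms(2)[of t] step by (simp add: map_bind_pmf pmf.map_comp o_def map_pmf_const map_pmf_def[symmetric])
  with step show ?case by simp
qed simp

lemma nn_integral_init_len:
  assumes "u < U"
  shows "(\<integral>\<^sup>+x. g (init_len x) \<partial>hist u t) = (\<integral>\<^sup>+q. g q \<partial>st u)"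
proof -
  have "(\<integral>\<^sup>+x. g (init_len x) \<partial>hist u t) = (\<integral>\<^sup>+q. g q \<partial>map_pmf init_len (hist u t))" by simp
  also have "map_pmf init_len (hist u t) = map_pmf init_len (hist u 0)"
    by (rule map_hist_const) (auto simp: next_history_def)
  also have "\<dots> = map_pmf (\<lambda>q. q u) (Pi_pmf {..<U} 0 st)"
    by (simp add: pmf.map_comp o_def)
  also have "\<dots> = st u" using assms by (subst Pi_pmf_component) auto
  finally show ?thesis .
qed

lemma nn_integral_explored:
  assumes "0 < l" "l \<le> t"
  shows "(\<integral>\<^sup>+x. ennreal (of_bool (explored x l)) \<partial>hist u t) = ennreal (explore_prob K l)"
proof -
  obtain l' where l: "l = Suc l'" using assms by (cases l) auto
  have "(\<integral>\<^sup>+x. ennreal (of_bool (explored x l)) \<partial>hist u t) = (\<integral>\<^sup>+e. ennreal (of_bool e) \<partial>map_pmf (\<lambda>x. explored x l) (hist u t))"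
    by simp
  also have "map_pmf (\<lambda>x. explored x l) (hist u t) = map_pmf (\<lambda>x. explored x l) (hist u l)"
    using assms by (intro map_hist_const) (auto simp: next_history_def)
  also have "(\<integral>\<^sup>+e. ennreal (of_bool e) \<partial>map_pmf (\<lambda>x. explored x l) (hist u l))
     = (\<integral>\<^sup>+x. \<integral>\<^sup>+c. ennreal (of_bool (fst c)) \<partial>decision l (cur x) \<partial>hist u l')"
    unfolding nn_integral_map_pmf l nn_integral_hist_Suc
    by (simp add: next_history_def measure_pmf.emeasure_space_1)
  also have "\<dots> = ennreal (explore_prob K l)"
    by (subst nn_integral_decision_fst) (simp add: measure_pmf.emeasure_space_1)
  finally show ?thesis .
qed

text \<open>The matching couples the queues: a wrong sample for another queue may take the best
  server away from \<open>u\<close>. Hence all queues are required to be sampled correctly, as in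
  \<open>sel_correct\<close>.\<close>

lemma nn_integral_erred_le:
  assumes u: "u < U" and l: "Suc l \<le> t"
  shows "(\<integral>\<^sup>+x. ennreal (of_bool (erred x (Suc l))) \<partial>hist u t)
     \<le> (\<integral>\<^sup>+x. emeasure (khat_pmf U K (cur x)) {kh. \<exists>v<U. kh v \<noteq> ks v} \<partial>hist u l)"
proof -
  have "(\<integral>\<^sup>+x. ennreal (of_bool (erred x (Suc l))) \<partial>hist u t)
     = (\<integral>\<^sup>+e. ennreal (of_bool e) \<partial>map_pmf (\<lambda>x. erred x (Suc l)) (hist u t))"
    by simp
  also have "map_pmf (\<lambda>x. erred x (Suc l)) (hist u t) = map_pmf (\<lambda>x. erred x (Suc l)) (hist u (Suc l))"
    using l by (intro map_hist_const) (auto simp: next_history_def)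
  also have "(\<integral>\<^sup>+e. ennreal (of_bool e) \<partial>map_pmf (\<lambda>x. erred x (Suc l)) (hist u (Suc l)))
     = (\<integral>\<^sup>+x. \<integral>\<^sup>+c. ennreal (of_bool (\<not> fst c \<and> snd c u \<noteq> Some (ks u))) \<partial>decision (Suc l) (cur x) \<partial>hist u l)"
    unfolding nn_integral_map_pmf nn_integral_hist_Suc
    by (simp add: next_history_def measure_pmf.emeasure_space_1)
  also have "\<dots> \<le> (\<integral>\<^sup>+x. emeasure (khat_pmf U K (cur x)) {kh. \<exists>v<U. kh v \<noteq> ks v} \<partial>hist u l)"
  proof (intro nn_integral_mono)
    fix x
    let ?s = "cur x"
    have "(\<integral>\<^sup>+c. ennreal (of_bool (\<not> fst c \<and> snd c u \<noteq> Some (ks u))) \<partial>decision (Suc l) ?s)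
      = (\<integral>\<^sup>+kh. ennreal (of_bool (sel (Suc l) ?s kh u \<noteq> Some (ks u))) \<partial>khat_pmf U K ?s) * ennreal (1 - explore_prob K (Suc l))"
      by (subst nn_integral_decision) simp
    also have "\<dots> \<le> (\<integral>\<^sup>+kh. ennreal (of_bool (sel (Suc l) ?s kh u \<noteq> Some (ks u))) \<partial>khat_pmf U K ?s) * 1"
      using explore_prob_range[of K "Suc l"] by (intro mult_left_mono) auto
    also have "\<dots> \<le> (\<integral>\<^sup>+kh. indicator {kh. \<exists>v<U. kh v \<noteq> ks v} kh \<partial>khat_pmf U K ?s)"
      using sel_correct[OF _ u] unfolding mult_1_right
      by (intro nn_integral_mono) (auto simp: indicator_def)
    also have "\<dots> = emeasure (khat_pmf U K ?s) {kh. \<exists>v<U. kh v \<noteq> ks v}" by simp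
    finally show "(\<integral>\<^sup>+c. ennreal (of_bool (\<not> fst c \<and> snd c u \<noteq> Some (ks u))) \<partial>decision (Suc l) ?s)
       \<le> emeasure (khat_pmf U K ?s) {kh. \<exists>v<U. kh v \<noteq> ks v}" .
  qed
  finally show ?thesis .
qed

end

section \<open>Errors of Thompson sampling\<close>

definition pulls :: "qstate \<Rightarrow> nat \<Rightarrow> nat \<Rightarrow> nat" where
  "pulls s u k = succ s u k + fail s u k"

text \<open>Either the pair was pulled fewer than N times, or its empirical mean is off by D/4, or the
  posterior sample is D/4 away from the empirical mean. The first two events are dominated by
  exponentials that are supermartingales along the adaptive sampling.\<close>
lemma beta_M_deviation_le:
  fixes a b l :: nat and q D N :: real
  assumes D: "D > 0" and N: "N > 0" and l: "a + b \<le> l"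
  defines "T \<equiv> real (a + b)"
  shows "emeasure (beta_M (real a + 1) (real b + 1)) {x. D / 2 \<le> \<bar>x - q\<bar>}
     \<le> ennreal (exp N) * ennreal (exp (- T))
       + (ennreal (exp (- N * D\<^sup>2 / 8)) * ennreal (exp (D * (real a - q * T) - T * D\<^sup>2 / 8))
        + ennreal (exp (- N * D\<^sup>2 / 8)) * ennreal (exp (- D * (real a - q * T) - T * D\<^sup>2 / 8)))
       + ennreal (2 * real (l + 1) * exp (- N * D\<^sup>2 / 8))" (is "?L \<le> ?A + (?B + ?C) + ?E")
proof -
  interpret prob_space "beta_M (real a + 1) (real b + 1)" by (rule prob_space_beta_M)
  have L1: "?L \<le> 1" by (rule emeasure_le_1)
  have exp1: "1 \<le> ennreal (exp x) * ennreal (exp y)" if "0 \<le> x + y" for x y :: real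
    using that by (simp flip: ennreal_mult exp_add)
  \<comment> \<open>In each of the first three cases one summand on the right is already at least 1.
    The tilt D is the maximiser of h T D / 4 - T h^2 / 8, and the resulting exponent T D^2 / 8
    equals 2 T (D/4)^2, the one of the Beta tail used in the last case.\<close>
  consider "T < N" | "T \<ge> N" "real a - q * T \<ge> T * D / 4" | "T \<ge> N" "- (real a - q * T) \<ge> T * D / 4"
    | "T \<ge> N" "\<bar>real a - q * T\<bar> < T * D / 4" by linarith
  thus ?thesis
  proof cases
    case 1
    have "?L \<le> ?A" using L1 exp1[of N "- T"] 1 by (auto intro: order_trans)
    thus ?thesis by (auto intro: order_trans add_increasing2 simp: add.assoc)
  next
    case 2
    have "D * (T * D / 4) \<le> D * (real a - q * T)" using 2 D by (intro mult_left_mono) auto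
    moreover have "N * D\<^sup>2 \<le> T * D\<^sup>2" using 2 by (intro mult_right_mono) auto
    ultimately have "?L \<le> ?B"
      by (intro order_trans[OF L1] exp1) (simp add: power2_eq_square field_simps)
    thus ?thesis by (auto intro: order_trans add_increasing add_increasing2)
  next
    case 3
    have "D * (T * D / 4) \<le> D * (- (real a - q * T))" using 3 D by (intro mult_left_mono) auto
    moreover have "N * D\<^sup>2 \<le> T * D\<^sup>2" using 3 by (intro mult_right_mono) auto
    ultimately have "?L \<le> ?C"
      by (intro order_trans[OF L1] exp1) (simp add: power2_eq_square field_simps)
    thus ?thesis by (auto intro: order_trans add_increasing add_increasing2)
  next
    case 4
    have T: "T > 0" using 4 N by simp
    have "\<bar>real a / T - q\<bar> < D / 4"
    proof -
      have "real a / T - q = (real a - q * T) / T" using T by (simp add: field_simps)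
      hence "\<bar>real a / T - q\<bar> = \<bar>real a - q * T\<bar> / T" using T by simp
      also have "\<dots> < D / 4" using 4 T by (simp add: field_simps)
      finally show ?thesis .
    qed
    hence "D / 4 \<le> \<bar>x - real a / T\<bar>" if "D / 2 \<le> \<bar>x - q\<bar>" for x
      using that by linarith
    hence "?L \<le> emeasure (beta_M (real a + 1) (real b + 1)) {x. D / 4 \<le> \<bar>x - real a / real (a + b)\<bar>}"
      unfolding T_def by (intro emeasure_mono Collect_mono) (auto simp: sets_beta_M)
    also have "\<dots> \<le> ennreal (real (a + b + 1) * (2 * exp (-2 * real (a + b) * (D / 4)\<^sup>2)))"
      using T D unfolding T_def by (intro beta_M_tail) auto
    also have "\<dots> \<le> ?E"
    proof -
      have "N * D\<^sup>2 \<le> T * D\<^sup>2" using 4 by (intro mult_right_mono) auto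
      hence "exp (-2 * real (a + b) * (D / 4)\<^sup>2) \<le> exp (- N * D\<^sup>2 / 8)"
        unfolding T_def by (simp add: power2_eq_square field_simps)
      hence "real (a + b + 1) * (2 * exp (-2 * real (a + b) * (D / 4)\<^sup>2)) \<le> real (l + 1) * (2 * exp (- N * D\<^sup>2 / 8))"
        using l by (intro mult_mono) auto
      also have "real (l + 1) * (2 * exp (- N * D\<^sup>2 / 8)) = 2 * real (l + 1) * exp (- N * D\<^sup>2 / 8)" by simp
      finally show ?thesis by (rule ennreal_leI)
    qed
    finally show ?thesis by (auto intro: order_trans add_increasing)
  qed
qed

context queueing_bandit
begin

lemma pulls_qupd:
  assumes "v < U"
  shows "pulls (qupd U ks s \<kappa> A R) v k = pulls s v k + of_bool (\<kappa> v = Some k)"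
  using assms by (auto simp: pulls_def qupd_def)

lemma pulls_le:
  assumes "x \<in> set_pmf (hist u t)" "v < U"
  shows "pulls (cur x) v k \<le> t"
  using assms
proof (induction t arbitrary: x)
  case 0
  thus ?case by (auto simp: pulls_def)
next
  case (Suc t)
  then obtain y A R c where y: "y \<in> set_pmf (hist u t)" "x = next_history u (Suc t) y A R c"
    by auto
  hence "pulls (cur x) v k = pulls (cur y) v k + of_bool (snd c v = Some k)"
    using Suc.prems by (simp add: next_history_def pulls_qupd)
  thus ?case using Suc.IH[OF y(1) Suc.prems(2)] by auto
qed

text \<open>Some exploration matching contains the pair and is drawn with probability 1/K; there the
  factor is exp (-1) <= 1/2. Elsewhere, in particular under exploitation, the trivial factor 1
  suffices.\<close>

lemma decision_pull_mgf_le: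
  assumes v: "v < U" and k: "k < K"
  shows "(\<integral>\<^sup>+c. ennreal (exp (- of_bool (snd c v = Some k))) \<partial>decision t s)
          \<le> ennreal (exp (- explore_prob K t / (2 * real K)))"
proof -
  let ?p = "explore_prob K t"
  have K: "real K > 0" using K_pos by simp
  obtain i0 where i0: "i0 < K" "Em i0 v = Some k" using Em_cover[OF v k] by auto
  have e1: "exp (-1) \<le> (1/2 :: real)"
  proof -
    have "2 \<le> exp (1::real)" using exp_ge_add_one_self[of 1] by simp
    thus ?thesis by (simp add: exp_minus field_simps)
  qed
  have "(\<integral>\<^sup>+i. ennreal (exp (- of_bool (Em i v = Some k))) \<partial>pmf_of_set {..<K})
     = ennreal ((\<Sum>i<K. exp (- of_bool (Em i v = Some k))) / real K)"
    using K_pos by (subst nn_integral_pmf_of_set)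
      (auto simp: lessThan_empty_iff sum_ennreal divide_ennreal ennreal_of_nat_eq_real_of_nat sum_nonneg)
  also have "\<dots> \<le> ennreal (1 - 1 / (2 * real K))"
  proof (intro ennreal_leI)
    have "(\<Sum>i<K. exp (- of_bool (Em i v = Some k)))
       = exp (- of_bool (Em i0 v = Some k)) + (\<Sum>i\<in>{..<K} - {i0}. exp (- of_bool (Em i v = Some k)) :: real)"
      using i0 by (intro sum.remove) auto
    also have "\<dots> \<le> 1/2 + (\<Sum>i\<in>{..<K} - {i0}. 1)"
      using i0 e1 by (intro add_mono sum_mono) auto
    also have "\<dots> = real K - 1/2" using i0 by (simp add: of_nat_diff)
    finally show "(\<Sum>i<K. exp (- of_bool (Em i v = Some k))) / real K \<le> 1 - 1 / (2 * real K)"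
      using K by (simp add: field_simps)
  qed
  finally have E: "(\<integral>\<^sup>+i. ennreal (exp (- of_bool (Em i v = Some k))) \<partial>pmf_of_set {..<K}) \<le> ennreal (1 - 1 / (2 * real K))" .
  have S: "(\<integral>\<^sup>+kh. ennreal (exp (- of_bool (sel t s kh v = Some k))) \<partial>khat_pmf U K s) \<le> 1"
  proof -
    have "(\<integral>\<^sup>+kh. ennreal (exp (- of_bool (sel t s kh v = Some k))) \<partial>khat_pmf U K s) \<le> (\<integral>\<^sup>+kh. 1 \<partial>khat_pmf U K s)"
      by (intro nn_integral_mono) auto
    thus ?thesis by (simp add: measure_pmf.emeasure_space_1)
  qed
  have "(\<integral>\<^sup>+c. ennreal (exp (- of_bool (snd c v = Some k))) \<partial>decision t s)
     \<le> ennreal (1 - 1 / (2 * real K)) * ennreal ?p + 1 * ennreal (1 - ?p)"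
    unfolding nn_integral_decision snd_conv by (intro add_mono mult_right_mono E S) auto
  also have "\<dots> = ennreal ((1 - 1 / (2 * real K)) * ?p + (1 - ?p))"
  proof -
    have "1 - 1 / (2 * real K) \<ge> 0" using K_pos by (simp add: field_simps)
    thus ?thesis using explore_prob_range[of K t] by (simp add: ennreal_mult)
  qed
  also have "(1 - 1 / (2 * real K)) * ?p + (1 - ?p) = 1 + (- ?p / (2 * real K))"
    by (simp add: algebra_simps)
  also have "ennreal \<dots> \<le> ennreal (exp (- ?p / (2 * real K)))"
    by (intro ennreal_leI exp_ge_add_one_self)
  finally show ?thesis .
qed

lemma pulls_mgf_le:
  assumes v: "v < U" and k: "k < K"
  shows "(\<integral>\<^sup>+x. ennreal (exp (- real (pulls (cur x) v k))) \<partial>hist u t)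
      \<le> ennreal (exp (- (\<Sum>l\<in>{0<..t}. explore_prob K l) / (2 * real K)))"
proof (induction t)
  case 0
  show ?case by (simp add: pulls_def measure_pmf.emeasure_space_1)
next
  case (Suc t)
  let ?S = "\<Sum>l\<in>{0<..t}. explore_prob K l"
  have "{0<..Suc t} = insert (Suc t) {0<..t}" by auto
  hence S: "(\<Sum>l\<in>{0<..Suc t}. explore_prob K l) = explore_prob K (Suc t) + ?S" by simp
  have e: "ennreal (exp (- real (pulls (cur (next_history u (Suc t) x A R c)) v k))) =
     ennreal (exp (- real (pulls (cur x) v k))) * ennreal (exp (- of_bool (snd c v = Some k)))" for x A R c
    using v by (simp add: next_history_def pulls_qupd flip: ennreal_mult exp_add)
  have "(\<integral>\<^sup>+x. ennreal (exp (- real (pulls (cur x) v k))) \<partial>hist u (Suc t))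
     = (\<integral>\<^sup>+x. ennreal (exp (- real (pulls (cur x) v k))) *
        (\<integral>\<^sup>+c. ennreal (exp (- of_bool (snd c v = Some k))) \<partial>decision (Suc t) (cur x)) \<partial>hist u t)"
    unfolding nn_integral_hist_Suc e by (simp add: nn_integral_cmult measure_pmf.emeasure_space_1)
  also have "\<dots> \<le> (\<integral>\<^sup>+x. ennreal (exp (- real (pulls (cur x) v k))) *
        ennreal (exp (- explore_prob K (Suc t) / (2 * real K))) \<partial>hist u t)"
    by (intro nn_integral_mono mult_left_mono decision_pull_mgf_le v k) auto
  also have "\<dots> = (\<integral>\<^sup>+x. ennreal (exp (- real (pulls (cur x) v k))) \<partial>hist u t) *
        ennreal (exp (- explore_prob K (Suc t) / (2 * real K)))"
    by (simp add: nn_integral_multc)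
  also have "\<dots> \<le> ennreal (exp (- ?S / (2 * real K))) * ennreal (exp (- explore_prob K (Suc t) / (2 * real K)))"
    by (intro mult_right_mono Suc) auto
  also have "\<dots> = ennreal (exp (- ?S / (2 * real K) + - explore_prob K (Suc t) / (2 * real K)))"
    by (subst exp_add, subst ennreal_mult) auto
  also have "- ?S / (2 * real K) + - explore_prob K (Suc t) / (2 * real K) = - (explore_prob K (Suc t) + ?S) / (2 * real K)"
    by (simp add: add_divide_distrib diff_divide_distrib)
  finally show ?case unfolding S .
qed

text \<open>The number of pulls is random and depends on past services, so a Hoeffding bound for a
  fixed sample size does not apply. The compensated exponential changes only in slots that pull the
  pair, and there the fresh service is independent of the decision, so Hoeffding's lemma bounds its
  mean factor by 1.\<close>

lemma empirical_mean_supermartingale: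
  assumes v: "v < U" and k: "k < K"
  shows "(\<integral>\<^sup>+x. ennreal (exp (h * (real (succ (cur x) v k) - mu v k * real (pulls (cur x) v k))
            - real (pulls (cur x) v k) * h\<^sup>2 / 8)) \<partial>hist u t) \<le> 1"
proof (induction t)
  case 0
  show ?case by (simp add: pulls_def measure_pmf.emeasure_space_1)
next
  case (Suc t)
  define M where "M = (\<lambda>s. ennreal (exp (h * (real (succ s v k) - mu v k * real (pulls s v k))
            - real (pulls s v k) * h\<^sup>2 / 8)))"
  let ?g = "\<lambda>(c :: bool \<times> (nat \<Rightarrow> nat option)) (R :: nat \<times> nat \<Rightarrow> bool).
     ennreal (if snd c v = Some k then exp (h * of_bool (R (v, k)) + (- h * mu v k - h\<^sup>2 / 8)) else 1)"
  have e: "M (cur (next_history u (Suc t) x A R c)) = M (cur x) * ?g c R" for x A R c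
  proof (cases "snd c v = Some k")
    case True
    hence "succ (cur (next_history u (Suc t) x A R c)) v k = succ (cur x) v k + of_bool (R (v, k))"
      using v by (simp add: next_history_def qupd_def)
    moreover have "pulls (cur (next_history u (Suc t) x A R c)) v k = pulls (cur x) v k + 1"
      using v True by (simp add: next_history_def pulls_qupd)
    ultimately show ?thesis
      using True unfolding M_def by (simp flip: ennreal_mult exp_add add: algebra_simps add_divide_distrib)
  next
    case False
    thus ?thesis using v by (simp add: M_def next_history_def pulls_qupd) (simp add: qupd_def)
  qed
  have g: "(\<integral>\<^sup>+R. ?g c R \<partial>services) \<le> 1" for c
  proof (cases "snd c v = Some k")
    case True
    have "(\<integral>\<^sup>+R. ennreal (exp (h * of_bool (R (v, k)) + (- h * mu v k - h\<^sup>2 / 8))) \<partial>services) \<le> 1"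
      using bernoulli_mgf_ennreal[of "mu v k" h "- h * mu v k - h\<^sup>2 / 8"] mu_range[OF v k]
      by (subst nn_integral_services[OF v k, where g = "\<lambda>a. ennreal (exp (h * of_bool a + (- h * mu v k - h\<^sup>2 / 8)))"])
         simp
    thus ?thesis using True by simp
  qed (simp add: measure_pmf.emeasure_space_1)
  have "(\<integral>\<^sup>+x. M (cur x) \<partial>hist u (Suc t)) =
     (\<integral>\<^sup>+x. M (cur x) * (\<integral>\<^sup>+c. \<integral>\<^sup>+R. ?g c R \<partial>services \<partial>decision (Suc t) (cur x)) \<partial>hist u t)"
    unfolding nn_integral_hist_Suc e by (simp add: nn_integral_cmult measure_pmf.emeasure_space_1)
  also have "\<dots> \<le> (\<integral>\<^sup>+x. M (cur x) * (\<integral>\<^sup>+c. 1 \<partial>decision (Suc t) (cur x)) \<partial>hist u t)"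
    by (intro nn_integral_mono mult_left_mono g) auto
  also have "\<dots> \<le> 1"
    using Suc by (simp add: measure_pmf.emeasure_space_1 M_def)
  finally show ?case by (simp add: M_def)
qed

text \<open>If a wrong server has the largest sample although its mean is lower by at least D, then
  its own sample or that of the best server is off by at least D/2.\<close>

lemma khat_error_subset:
  assumes gap: "\<And>v k. v < U \<Longrightarrow> k < K \<Longrightarrow> k \<noteq> ks v \<Longrightarrow> mu v (ks v) - mu v k \<ge> D"
  shows "khat K -` {kh. \<exists>v<U. kh v \<noteq> ks v} \<inter> space (beta_prod U K s) \<subseteq>
    (\<Union>v\<in>{..<U}. \<Union>k\<in>{..<K}. {\<theta> \<in> space (beta_prod U K s). \<theta> (v, k) \<in> {x. D / 2 \<le> \<bar>x - mu v k\<bar>}})"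
proof
  fix \<theta> assume "\<theta> \<in> khat K -` {kh. \<exists>v<U. kh v \<noteq> ks v} \<inter> space (beta_prod U K s)"
  then obtain v where v: "v < U" "khat K \<theta> v \<noteq> ks v" and th: "\<theta> \<in> space (beta_prod U K s)" by auto
  define k where "k = khat K \<theta> v"
  have k: "k < K" "\<theta> (v, ks v) \<le> \<theta> (v, k)"
    using khat_props[OF K_pos] ks_props(1)[OF v(1)] by (auto simp: k_def)
  have "mu v (ks v) - mu v k \<ge> D" using gap v k by (simp add: k_def)
  hence "D / 2 \<le> \<bar>\<theta> (v, k) - mu v k\<bar> \<or> D / 2 \<le> \<bar>\<theta> (v, ks v) - mu v (ks v)\<bar>"
    using k(2) by argo
  thus "\<theta> \<in> (\<Union>v\<in>{..<U}. \<Union>k\<in>{..<K}. {\<theta> \<in> space (beta_prod U K s). \<theta> (v, k) \<in> {x. D / 2 \<le> \<bar>x - mu v k\<bar>}})"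
    using v(1) k(1) ks_props(1)[OF v(1)] th by blast
qed

lemma khat_error_le:
  assumes gap: "\<And>v k. v < U \<Longrightarrow> k < K \<Longrightarrow> k \<noteq> ks v \<Longrightarrow> mu v (ks v) - mu v k \<ge> D"
  shows "emeasure (khat_pmf U K s) {kh. \<exists>v<U. kh v \<noteq> ks v} \<le>
     (\<Sum>v<U. \<Sum>k<K. emeasure (beta_M (real (succ s v k) + 1) (real (fail s v k) + 1)) {x. D / 2 \<le> \<bar>x - mu v k\<bar>})"
proof -
  let ?M = "beta_prod U K s"
  let ?B = "\<lambda>v k. {\<theta> \<in> space ?M. \<theta> (v, k) \<in> {x. D / 2 \<le> \<bar>x - mu v k\<bar>}}"
  have B: "?B v k \<in> sets ?M" if "v < U" "k < K" for v k
    using measurable_sets[OF measurable_beta_prod_component[OF that, of s], of "{x. D / 2 \<le> \<bar>x - mu v k\<bar>}"]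
    by (simp add: vimage_def Int_def conj_commute)
  have "emeasure (khat_pmf U K s) {kh. \<exists>v<U. kh v \<noteq> ks v}
     = emeasure ?M (khat K -` {kh. \<exists>v<U. kh v \<noteq> ks v} \<inter> space ?M)"
    unfolding measure_pmf_khat_pmf[OF K_pos] using measurable_khat[OF K_pos] by (subst emeasure_distr) auto
  also have "\<dots> \<le> emeasure ?M (\<Union>v\<in>{..<U}. \<Union>k\<in>{..<K}. ?B v k)"
    using khat_error_subset[OF gap] B by (intro emeasure_mono sets.finite_UN) auto
  also have "\<dots> \<le> (\<Sum>v<U. emeasure ?M (\<Union>k\<in>{..<K}. ?B v k))"
    using B by (intro emeasure_subadditive_finite) (auto intro!: sets.finite_UN)
  also have "\<dots> \<le> (\<Sum>v<U. \<Sum>k<K. emeasure ?M (?B v k))"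
    using B by (intro sum_mono emeasure_subadditive_finite) auto
  also have "\<dots> = (\<Sum>v<U. \<Sum>k<K. emeasure (beta_M (real (succ s v k) + 1) (real (fail s v k) + 1)) {x. D / 2 \<le> \<bar>x - mu v k\<bar>})"
    by (intro sum.cong refl emeasure_beta_prod_component) auto
  finally show ?thesis .
qed

text \<open>\<open>N\<close> is a free threshold on the number of pulls: raising it improves the
  concentration terms and worsens the term for too few pulls. The two tilts and the Beta tail add up
  to the coefficient 2 + 2 (l + 1).\<close>

lemma exploit_error_le:
  assumes gap: "\<And>v k. v < U \<Longrightarrow> k < K \<Longrightarrow> k \<noteq> ks v \<Longrightarrow> mu v (ks v) - mu v k \<ge> D"
    and D: "D > 0" and N: "N > 0"
  shows "(\<integral>\<^sup>+x. emeasure (khat_pmf U K (cur x)) {kh. \<exists>v<U. kh v \<noteq> ks v} \<partial>hist u l)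
    \<le> ennreal (real U * real K * (exp (N - (\<Sum>j\<in>{0<..l}. explore_prob K j) / (2 * real K))
                + (2 * real l + 4) * exp (- N * D\<^sup>2 / 8)))"
proof -
  let ?S = "(\<Sum>j\<in>{0<..l}. explore_prob K j) / (2 * real K)"
  let ?d = "exp (- N * D\<^sup>2 / 8)"
  let ?b = "\<lambda>s v k. emeasure (beta_M (real (succ s v k) + 1) (real (fail s v k) + 1)) {x. D / 2 \<le> \<bar>x - mu v k\<bar>}"
  let ?M = "\<lambda>h s v k. ennreal (exp (h * (real (succ s v k) - mu v k * real (pulls s v k)) - real (pulls s v k) * h\<^sup>2 / 8))"
  have pair: "(\<integral>\<^sup>+x. ?b (cur x) v k \<partial>hist u l) \<le> ennreal (exp (N - ?S) + (2 * real l + 4) * ?d)"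
    if v: "v < U" and k: "k < K" for v k
  proof -
    have "(\<integral>\<^sup>+x. ?b (cur x) v k \<partial>hist u l) \<le> (\<integral>\<^sup>+x. ennreal (exp N) * ennreal (exp (- real (pulls (cur x) v k)))
        + (ennreal ?d * ?M D (cur x) v k + ennreal ?d * ?M (- D) (cur x) v k)
        + ennreal (2 * real (l + 1) * ?d) \<partial>hist u l)"
    proof (intro nn_integral_mono_AE)
      have "?b (cur x) v k \<le> ennreal (exp N) * ennreal (exp (- real (pulls (cur x) v k)))
        + (ennreal ?d * ?M D (cur x) v k + ennreal ?d * ?M (- D) (cur x) v k)
        + ennreal (2 * real (l + 1) * ?d)" if "x \<in> set_pmf (hist u l)" for x
        using beta_M_deviation_le[OF D N, of "succ (cur x) v k" "fail (cur x) v k" l "mu v k"] pulls_le[OF that v, of k]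
        unfolding pulls_def by simp
      thus "AE x in hist u l. ?b (cur x) v k \<le> ennreal (exp N) * ennreal (exp (- real (pulls (cur x) v k)))
        + (ennreal ?d * ?M D (cur x) v k + ennreal ?d * ?M (- D) (cur x) v k)
        + ennreal (2 * real (l + 1) * ?d)"
        by (auto simp: AE_measure_pmf_iff)
    qed
    also have "\<dots> = ennreal (exp N) * (\<integral>\<^sup>+x. ennreal (exp (- real (pulls (cur x) v k))) \<partial>hist u l)
        + (ennreal ?d * (\<integral>\<^sup>+x. ?M D (cur x) v k \<partial>hist u l) + ennreal ?d * (\<integral>\<^sup>+x. ?M (- D) (cur x) v k \<partial>hist u l))
        + ennreal (2 * real (l + 1) * ?d)"
      by (simp add: nn_integral_add nn_integral_cmult measure_pmf.emeasure_space_1)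
    also have "\<dots> \<le> ennreal (exp N) * ennreal (exp (- (\<Sum>l\<in>{0<..l}. explore_prob K l) / (2 * real K)))
        + (ennreal ?d * 1 + ennreal ?d * 1) + ennreal (2 * real (l + 1) * ?d)"
      by (intro add_mono mult_left_mono pulls_mgf_le empirical_mean_supermartingale v k) auto
    also have "\<dots> = ennreal (exp (N - ?S) + (2 * real l + 4) * ?d)"
      by (simp flip: ennreal_mult exp_add ennreal_plus) (simp add: algebra_simps)
    finally show ?thesis .
  qed
  have "(\<integral>\<^sup>+x. emeasure (khat_pmf U K (cur x)) {kh. \<exists>v<U. kh v \<noteq> ks v} \<partial>hist u l)
     \<le> (\<integral>\<^sup>+x. (\<Sum>v<U. \<Sum>k<K. ?b (cur x) v k) \<partial>hist u l)"
    by (intro nn_integral_mono khat_error_le gap)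
  also have "\<dots> = (\<Sum>v<U. \<Sum>k<K. (\<integral>\<^sup>+x. ?b (cur x) v k \<partial>hist u l))"
    by (simp add: nn_integral_sum)
  also have "\<dots> \<le> (\<Sum>v<U. \<Sum>k<K. ennreal (exp (N - ?S) + (2 * real l + 4) * ?d))"
    by (intro sum_mono pair) auto
  also have "\<dots> = ennreal (real U * real K * (exp (N - ?S) + (2 * real l + 4) * ?d))"
    by (simp add: ennreal_of_nat_eq_real_of_nat ennreal_mult' mult.assoc)
  finally show ?thesis .
qed

end

section \<open>Comparison with the genie queue\<close>

text \<open>\<open>ennreal\<close> keeps the positive part, and the negative part only lowers the
  integral. A function that is not integrable has integral 0 by convention, which is covered by 0 <=
  c.\<close>

lemma integral_le_of_nn_integral_le:
  fixes f :: "'a \<Rightarrow> real"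
  assumes "(\<integral>\<^sup>+x. ennreal (f x) \<partial>M) \<le> ennreal c" "0 \<le> c"
  shows "(\<integral>x. f x \<partial>M) \<le> c"
proof (cases "integrable M f")
  case True
  have "(\<integral>x. f x \<partial>M) \<le> enn2real (\<integral>\<^sup>+x. ennreal (f x) \<partial>M)"
    by (subst real_lebesgue_integral_def[OF True]) simp
  also have "\<dots> \<le> c"
    using enn2real_mono[OF assms(1)] assms(2) by simp
  finally show ?thesis .
qed (simp add: not_integrable_integral_eq assms)

context queueing_bandit
begin

text \<open>An exploring slot counts even if its matching happens to contain the best server, so
  that this part of the count depends on the coin alone. The two flags exclude each other along a
  history, so the value is 0 or 1.\<close>

definition bad :: "history \<Rightarrow> nat \<Rightarrow> int" where
  "bad x l = of_bool (explored x l) + of_bool (erred x l)"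

definition total :: "history \<Rightarrow> nat \<Rightarrow> nat \<Rightarrow> int" where
  "total x r t = (\<Sum>l\<in>{r<..t}. drift x l + bad x l)"

lemma Qa_next_history_le:
  assumes "x = next_history u (Suc t) y A R c"
  shows "int (Qa (cur x) u) \<le> max 0 (int (Qa (cur y) u) + drift x (Suc t) + bad x (Suc t))"
    and "int (Qg (cur x) u) = max 0 (int (Qg (cur y) u) + drift x (Suc t))"
    and "Qa (cur x) u \<le> Qa (cur y) u + 1"
    and "Qa (cur x) u + Qg (cur y) u \<le> Qg (cur x) u + Qa (cur y) u + 1"
proof -
  define S :: nat where "S = (case snd c u of None \<Rightarrow> 0 | Some k \<Rightarrow> of_bool (R (u, k)))"
  have S1: "S \<le> 1" by (simp add: S_def split: option.split)
  \<comment> \<open>If the best server is assigned, both queues see the same service; otherwise the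
    slot is bad and the surplus of the genie is at most 1.\<close>
  have S2: "of_bool (R (u, ks u)) \<le> int S + bad x (Suc t)"
    by (cases "snd c u = Some (ks u)") (simp_all add: S_def bad_def assms next_history_def)
  have d: "drift x (Suc t) = of_bool (A u) - of_bool (R (u, ks u))"
    by (simp add: assms next_history_def)
  have qa: "Qa (cur x) u = Qa (cur y) u + of_bool (A u) - S"
    by (simp add: assms next_history_def qupd_def S_def)
  have qg: "Qg (cur x) u = Qg (cur y) u + of_bool (A u) - of_bool (R (u, ks u))"
    by (simp add: assms next_history_def qupd_def)
  have mx: "int (p - q) = max 0 (int p - int q)" for p q :: nat by linarith
  show "int (Qa (cur x) u) \<le> max 0 (int (Qa (cur y) u) + drift x (Suc t) + bad x (Suc t))"
    unfolding qa mx d using S2 by simp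
  show "int (Qg (cur x) u) = max 0 (int (Qg (cur y) u) + drift x (Suc t))"
    unfolding qg mx d by simp
  show "Qa (cur x) u \<le> Qa (cur y) u + 1"
    unfolding qa by (cases "A u") auto
  show "Qa (cur x) u + Qg (cur y) u \<le> Qg (cur x) u + Qa (cur y) u + 1"
    unfolding qa qg by (cases "A u"; cases "R (u, ks u)") auto
qed

lemma history_next_history:
  assumes "x = next_history u (Suc t) y A R c" "l \<le> t"
  shows "drift x l = drift y l" "bad x l = bad y l" "init_len x = init_len y"
  using assms by (auto simp: next_history_def bad_def)

lemma sum_greaterThanAtMost_Suc:
  fixes f :: "nat \<Rightarrow> 'a :: comm_monoid_add"
  assumes "r \<le> t"
  shows "sum f {r<..Suc t} = sum f {r<..t} + f (Suc t)"
proof -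
  have "{r<..Suc t} = insert (Suc t) {r<..t}" using assms by auto
  thus ?thesis by (simp add: add.commute)
qed

lemma sum_bad_next_history:
  assumes "x = next_history u (Suc t) y A R c" "r \<le> t"
  shows "sum (bad x) {r<..Suc t} = sum (bad y) {r<..t} + bad x (Suc t)"
proof -
  have "sum (bad x) {r<..t} = sum (bad y) {r<..t}"
    using history_next_history(2)[OF assms(1)] by (intro sum.cong) auto
  thus ?thesis using sum_greaterThanAtMost_Suc[OF assms(2), of "bad x"] by simp
qed

lemma total_next_history:
  assumes "x = next_history u (Suc t) y A R c" "r \<le> t"
  shows "total x r (Suc t) = total y r t + drift x (Suc t) + bad x (Suc t)"
proof -
  have "(\<Sum>l\<in>{r<..t}. drift x l + bad x l) = (\<Sum>l\<in>{r<..t}. drift y l + bad y l)"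
    using history_next_history[OF assms(1)] by (intro sum.cong) auto
  thus ?thesis unfolding total_def sum_greaterThanAtMost_Suc[OF assms(2)] by simp
qed

lemma set_hist_Suc:
  assumes "x \<in> set_pmf (hist u (Suc t))"
  obtains y A R c where "y \<in> set_pmf (hist u t)" "x = next_history u (Suc t) y A R c"
  using assms by auto

lemma Qa_le_init_len:
  assumes "x \<in> set_pmf (hist u t)"
  shows "Qa (cur x) u \<le> init_len x + t"
  using assms
proof (induction t arbitrary: x)
  case (Suc t)
  obtain y A R c where y: "y \<in> set_pmf (hist u t)" "x = next_history u (Suc t) y A R c"
    using Suc.prems by (rule set_hist_Suc)
  show ?case
    using Qa_next_history_le(3)[OF y(2)] history_next_history(3)[OF y(2) order_refl] Suc.IH[OF y(1)] by simp
qed auto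

lemma Qa_le_Qg:
  assumes "x \<in> set_pmf (hist u t)"
  shows "Qa (cur x) u \<le> Qg (cur x) u + t"
  using assms
proof (induction t arbitrary: x)
  case (Suc t)
  obtain y A R c where y: "y \<in> set_pmf (hist u t)" "x = next_history u (Suc t) y A R c"
    using Suc.prems by (rule set_hist_Suc)
  show ?case
    using Qa_next_history_le(4)[OF y(2)] Suc.IH[OF y(1)] by linarith
qed auto

text \<open>Either the positive part was never active after \<tau>, and the queue started there from
  at most its initial length plus \<tau> arrivals, or r can be taken as the last slot at which the
  queue was empty.\<close>

lemma Qa_lindley:
  assumes "x \<in> set_pmf (hist u t)" "\<tau> \<le> t"
  shows "int (Qa (cur x) u) \<le> int (init_len x + \<tau>) + total x \<tau> t \<or>
     (\<exists>r\<in>{\<tau>..t}. int (Qa (cur x) u) \<le> total x r t)"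
  using assms(2,1)
proof (induction t arbitrary: x rule: dec_induct)
  case base
  thus ?case using Qa_le_init_len[OF base] by (simp add: total_def)
next
  case (step t)
  obtain y A R c where y: "y \<in> set_pmf (hist u t)" "x = next_history u (Suc t) y A R c"
    using step.prems by (rule set_hist_Suc)
  note q = Qa_next_history_le(1)[OF y(2)]
  show ?case
  proof (cases "int (Qa (cur x) u) \<le> 0")
    case True
    hence "int (Qa (cur x) u) \<le> total x (Suc t) (Suc t)" by (simp add: total_def)
    thus ?thesis using step.hyps by (intro disjI2 bexI[of _ "Suc t"]) auto
  next
    case False
    hence q': "int (Qa (cur x) u) \<le> int (Qa (cur y) u) + drift x (Suc t) + bad x (Suc t)"
      using q by linarith
    from step.IH[OF y(1)] show ?thesis
    proof
      assume "int (Qa (cur y) u) \<le> int (init_len y + \<tau>) + total y \<tau> t"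
      thus ?thesis using q' total_next_history[OF y(2) step.hyps(1)] history_next_history(3)[OF y(2) order_refl]
        by (intro disjI1) simp
    next
      assume "\<exists>r\<in>{\<tau>..t}. int (Qa (cur y) u) \<le> total y r t"
      then obtain r where r: "r \<in> {\<tau>..t}" "int (Qa (cur y) u) \<le> total y r t" by auto
      have "total x r (Suc t) = total y r t + drift x (Suc t) + bad x (Suc t)"
        using r by (intro total_next_history[OF y(2)]) auto
      thus ?thesis using q' r by (intro disjI2 bexI[of _ r]) auto
    qed
  qed
qed

text \<open>If the queue was empty at some slot after m, then from there on it exceeds the genie queue by
  at most the number of slots that miss the best server.\<close>
lemma Qa_le_Qg_plus_bad:
  assumes "x \<in> set_pmf (hist u t)" "\<tau> \<le> m" "m \<le> t"
  shows "int (Qa (cur x) u) \<le> int (init_len x + \<tau>) + total x \<tau> t \<or>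
     (\<exists>r\<in>{\<tau>..<m}. int (Qa (cur x) u) \<le> total x r t) \<or>
     int (Qa (cur x) u) \<le> int (Qg (cur x) u) + sum (bad x) {m<..t}"
  using assms(3,1)
proof (induction t arbitrary: x rule: dec_induct)
  case base
  show ?case
  \<comment> \<open>The empty window r = m says that the queue is empty and belongs to the third
    alternative. The remaining windows start strictly before m.\<close>
  proof (cases "int (Qa (cur x) u) \<le> total x m m")
    case True
    thus ?thesis by (simp add: total_def)
  next
    case False
    have "\<exists>r\<in>{\<tau>..<m}. int (Qa (cur x) u) \<le> total x r m" if "r \<in> {\<tau>..m}" "int (Qa (cur x) u) \<le> total x r m" for r
      using that False by (cases "r = m") auto
    thus ?thesis using Qa_lindley[OF base assms(2)] by blast
  qed
next
  case (step t)
  obtain y A R c where y: "y \<in> set_pmf (hist u t)" "x = next_history u (Suc t) y A R c"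
    using step.prems by (rule set_hist_Suc)
  have bad0: "bad z l \<ge> 0" for z l by (simp add: bad_def)
  note q = Qa_next_history_le(1)[OF y(2)]
  note g = Qa_next_history_le(2)[OF y(2)]
  note b = sum_bad_next_history[OF y(2) step.hyps(1)]
  show ?case
  proof (cases "int (Qa (cur x) u) \<le> 0")
    case True
    have "sum (bad x) {m<..Suc t} \<ge> 0" by (intro sum_nonneg bad0)
    thus ?thesis using True by simp
  next
    case False
    hence q': "int (Qa (cur x) u) \<le> int (Qa (cur y) u) + drift x (Suc t) + bad x (Suc t)"
      using q by linarith
    from step.IH[OF y(1)] show ?thesis
    proof (elim disjE)
      assume "int (Qa (cur y) u) \<le> int (init_len y + \<tau>) + total y \<tau> t"
      moreover have "total x \<tau> (Suc t) = total y \<tau> t + drift x (Suc t) + bad x (Suc t)"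
        using step.hyps assms by (intro total_next_history[OF y(2)]) auto
      ultimately show ?thesis using q' history_next_history(3)[OF y(2) order_refl]
        by (intro disjI1) simp
    next
      assume "\<exists>r\<in>{\<tau>..<m}. int (Qa (cur y) u) \<le> total y r t"
      then obtain r where r: "r \<in> {\<tau>..<m}" "int (Qa (cur y) u) \<le> total y r t" by auto
      have "total x r (Suc t) = total y r t + drift x (Suc t) + bad x (Suc t)"
        using r step.hyps by (intro total_next_history[OF y(2)]) auto
      thus ?thesis using q' r by (intro disjI2 disjI1 bexI[of _ r]) auto
    next
      assume "int (Qa (cur y) u) \<le> int (Qg (cur y) u) + sum (bad y) {m<..t}"
      \<comment> \<open>The positive part makes the genie queue at least its predecessor plus the
        drift. The common drift cancels, and only the bad slots accumulate.\<close>
      thus ?thesis using q' g b by (intro disjI2) linarith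
    qed
  qed
qed

text \<open>Markov's inequality in pointwise form: each exceptional event is dominated by a
  nonnegative quantity that is at least 1 on it, and there the difference is bounded crudely by t.
  Expectations can then be taken term by term.\<close>

lemma regret_pointwise_le:
  fixes qb :: nat
  assumes x: "x \<in> set_pmf (hist u t)" and m: "\<tau> \<le> m" "m \<le> t" and \<theta>: "\<theta> > 0"
  shows "real (Qa (cur x) u) - real (Qg (cur x) u) \<le>
      (\<Sum>l\<in>{m<..t}. of_bool (explored x l)) + (\<Sum>l\<in>{m<..t}. of_bool (erred x l))
      + real t * (of_bool (qb \<le> init_len x) + exp (\<theta> * (real \<tau> + real qb)) * exp (\<theta> * load x \<tau> t)
          + (\<Sum>r\<in>{\<tau>..<m}. exp (\<theta> * load x r t)) + (\<Sum>l\<in>{\<tau><..t}. of_bool (erred x l)))"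
    (is "?D \<le> ?b1 + ?b2 + real t * (?i + ?e + ?s + ?r)")
proof -
  have nn: "?b1 \<ge> 0" "?b2 \<ge> 0" "?i \<ge> 0" "?e \<ge> 0" "?s \<ge> 0" "?r \<ge> 0"
    by (auto intro!: sum_nonneg)
  have Dt: "?D \<le> real t" using Qa_le_Qg[OF x] by linarith
  have big: ?thesis if "1 \<le> ?i + ?e + ?s + ?r"
  proof -
    have "real t * 1 \<le> real t * (?i + ?e + ?s + ?r)" using that by (intro mult_left_mono) auto
    thus ?thesis using Dt nn by linarith
  qed
  consider "\<exists>l\<in>{\<tau><..t}. erred x l" | "qb \<le> init_len x" | "Qa (cur x) u = 0"
    | "\<forall>l\<in>{\<tau><..t}. \<not> erred x l" "init_len x < qb" "Qa (cur x) u > 0"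
    by force
  thus ?thesis
  proof cases
    case 1
    then obtain l where l: "l \<in> {\<tau><..t}" "erred x l" by auto
    hence "(of_bool (erred x l) :: real) \<le> ?r" by (intro member_le_sum) auto
    hence "1 \<le> ?r" using l by simp
    thus ?thesis using nn by (intro big) linarith
  next
    case 2
    thus ?thesis using nn by (intro big) simp
  next
    case 3
    have "0 \<le> real t * (?i + ?e + ?s + ?r)" using nn by simp
    moreover have "?D \<le> 0" using 3 by simp
    ultimately show ?thesis using nn by linarith
  next
    case 4
    \<comment> \<open>Without an error after \<tau>, every \<open>total\<close> over such a window
      is a \<open>load\<close>, whose exponential moments are controlled.\<close>
    have tot: "real_of_int (total x r t) = load x r t" if "r \<ge> \<tau>" for r
    proof -
      have "(\<Sum>l\<in>{r<..t}. drift x l + bad x l) = (\<Sum>l\<in>{r<..t}. drift x l + of_bool (explored x l))"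
        using 4(1) that by (intro sum.cong) (auto simp: bad_def)
      thus ?thesis by (simp add: total_def load_def)
    qed
    from Qa_le_Qg_plus_bad[OF x m] show ?thesis
    proof (elim disjE)
      assume "int (Qa (cur x) u) \<le> int (init_len x + \<tau>) + total x \<tau> t"
      hence "0 \<le> real qb + real \<tau> + load x \<tau> t"
        using 4 tot[of \<tau>] by linarith
      hence "0 \<le> \<theta> * (real \<tau> + real qb + load x \<tau> t)" using \<theta> by (intro mult_nonneg_nonneg) auto
      hence "1 \<le> exp (\<theta> * (real \<tau> + real qb) + \<theta> * load x \<tau> t)" by (simp add: algebra_simps)
      hence "1 \<le> ?e" by (simp only: exp_add)
      thus ?thesis using nn by (intro big) linarith
    next
      assume "\<exists>r\<in>{\<tau>..<m}. int (Qa (cur x) u) \<le> total x r t"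
      then obtain r where r: "r \<in> {\<tau>..<m}" "int (Qa (cur x) u) \<le> total x r t" by auto
      hence "0 \<le> load x r t" using tot[of r] by simp
      hence "1 \<le> exp (\<theta> * load x r t)" using \<theta> by simp
      also have "\<dots> \<le> ?s" using r by (intro member_le_sum) auto
      finally show ?thesis using nn by (intro big) linarith
    next
      assume *: "int (Qa (cur x) u) \<le> int (Qg (cur x) u) + sum (bad x) {m<..t}"
      have "real_of_int (sum (bad x) {m<..t}) = ?b1 + ?b2"
        by (simp add: bad_def sum.distrib)
      hence "?D \<le> ?b1 + ?b2" using * by linarith
      moreover have "0 \<le> real t * (?i + ?e + ?s + ?r)" using nn by simp
      ultimately show ?thesis by linarith
    qed
  qed
qed

lemma eps_le_1: "u < U \<Longrightarrow> epsq K lam mu u \<le> 1"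
  using lam_range[of u] mu_range[of u "ks u"] ks_props(1,2)[of u] by (simp add: epsq_def)

text \<open>The parameter \<theta> = e is admissible because e <= 1 and yields - e^2 + e^2 / 4 = -
  (3/4) e^2 per slot.\<close>

lemma regret_le:
  fixes qb :: nat
  assumes u: "u < U" and m: "\<tau> \<le> m" "m \<le> t" and \<delta>: "\<delta> \<ge> 0"
    and err: "\<And>l. l \<in> {\<tau><..t} \<Longrightarrow> (\<integral>\<^sup>+x. ennreal (of_bool (erred x l)) \<partial>hist u t) \<le> ennreal \<delta>"
  defines "e \<equiv> epsq K lam mu u"
  defines "G \<equiv> \<lambda>r. - (3/4) * e\<^sup>2 * real (t - r) + 2 * e * (\<Sum>l\<in>{r<..t}. explore_prob K l)"
  shows "regret U K lam mu Em sel st u t \<le>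
     (\<Sum>l\<in>{m<..t}. explore_prob K l) + real (t - m) * \<delta>
     + real t * (exp (- e * real qb) + exp (e * (real \<tau> + real qb)) * exp (G \<tau>)
         + (\<Sum>r\<in>{\<tau>..<m}. exp (G r)) + real (t - \<tau>) * \<delta>)" (is "_ \<le> ?R")
proof -
  have e: "0 < e" "e \<le> 1" using eps_pos[OF u] eps_le_1[OF u] by (auto simp: e_def)
  have R0: "0 \<le> ?R"
    using \<delta> by (intro add_nonneg_nonneg mult_nonneg_nonneg sum_nonneg explore_prob_range) auto
  have G: "(\<integral>\<^sup>+x. ennreal (exp (e * load x r t)) \<partial>hist u t) \<le> ennreal (exp (G r))" if "r \<le> t" for r
    using load_mgf_le[OF u _ e(2) that] e unfolding G_def e_def
    by (simp add: power2_eq_square algebra_simps)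
  have I: "(\<integral>\<^sup>+x. ennreal (of_bool (qb \<le> init_len x)) \<partial>hist u t) \<le> ennreal (exp (- e * real qb))"
  proof -
    have "(\<integral>\<^sup>+x. ennreal (of_bool (qb \<le> init_len x)) \<partial>hist u t) = (\<integral>\<^sup>+q. indicator {qb..} q \<partial>st u)"
      by (subst nn_integral_init_len[OF u, where g = "\<lambda>q. ennreal (of_bool (qb \<le> q))"],
          rule nn_integral_cong) (simp add: indicator_def)
    also have "\<dots> = ennreal (measure_pmf.prob (st u) {qb..})"
      by (simp add: measure_pmf.emeasure_eq_measure)
    also have "\<dots> \<le> ennreal (exp (- e * real qb))"
      using queue_stationary_tail[OF stationary[OF u], of qb] lam_range[OF u] mu_range[OF u ks_props(1)[OF u]]
        ks_props(2)[OF u] eps_pos[OF u]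
      by (intro ennreal_leI) (simp add: e_def epsq_def)
    finally show ?thesis .
  qed
  have comb: "ennreal a + ennreal b + ennreal c * (ennreal d + ennreal f * ennreal g + ennreal h + ennreal i)
      = ennreal (a + b + c * (d + f * g + h + i))"
    if "a \<ge> 0" "b \<ge> 0" "c \<ge> 0" "d \<ge> 0" "f \<ge> 0" "g \<ge> 0" "h \<ge> 0" "i \<ge> 0" for a b c d f g h i
    using that by (simp add: ennreal_mult)
  have SB: "(\<Sum>l\<in>B. ennreal (of_bool (P l))) = ennreal (\<Sum>l\<in>B. of_bool (P l))" for B :: "nat set" and P
    by (rule sum_ennreal) simp
  have SE: "(\<Sum>l\<in>B. ennreal (exp (f l))) = ennreal (\<Sum>l\<in>B. exp (f l))" for B :: "nat set" and f
    by (rule sum_ennreal) simp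
  have SP: "(\<Sum>l\<in>B. ennreal (explore_prob K l)) = ennreal (\<Sum>l\<in>B. explore_prob K l)" for B :: "nat set"
    by (rule sum_ennreal) (rule explore_prob_range)
  have "(\<integral>\<^sup>+x. ennreal (real (Qa (cur x) u) - real (Qg (cur x) u)) \<partial>hist u t) \<le>
      (\<integral>\<^sup>+x. (\<Sum>l\<in>{m<..t}. ennreal (of_bool (explored x l))) + (\<Sum>l\<in>{m<..t}. ennreal (of_bool (erred x l)))
      + ennreal (real t) * (ennreal (of_bool (qb \<le> init_len x)) + ennreal (exp (e * (real \<tau> + real qb))) * ennreal (exp (e * load x \<tau> t))
          + (\<Sum>r\<in>{\<tau>..<m}. ennreal (exp (e * load x r t))) + (\<Sum>l\<in>{\<tau><..t}. ennreal (of_bool (erred x l)))) \<partial>hist u t)"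
  proof (intro nn_integral_mono_AE, unfold AE_measure_pmf_iff, intro ballI)
    fix x assume x: "x \<in> set_pmf (hist u t)"
    show "ennreal (real (Qa (cur x) u) - real (Qg (cur x) u)) \<le>
      (\<Sum>l\<in>{m<..t}. ennreal (of_bool (explored x l))) + (\<Sum>l\<in>{m<..t}. ennreal (of_bool (erred x l)))
      + ennreal (real t) * (ennreal (of_bool (qb \<le> init_len x)) + ennreal (exp (e * (real \<tau> + real qb))) * ennreal (exp (e * load x \<tau> t))
          + (\<Sum>r\<in>{\<tau>..<m}. ennreal (exp (e * load x r t))) + (\<Sum>l\<in>{\<tau><..t}. ennreal (of_bool (erred x l))))"
      unfolding SB SE
      by (intro order_trans[OF ennreal_leI[OF regret_pointwise_le[OF x m e(1), of qb]] eq_refl[OF comb[symmetric]]] sum_nonneg)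
         auto
  qed
  also have "\<dots> = (\<Sum>l\<in>{m<..t}. (\<integral>\<^sup>+x. ennreal (of_bool (explored x l)) \<partial>hist u t))
      + (\<Sum>l\<in>{m<..t}. (\<integral>\<^sup>+x. ennreal (of_bool (erred x l)) \<partial>hist u t))
      + ennreal (real t) * ((\<integral>\<^sup>+x. ennreal (of_bool (qb \<le> init_len x)) \<partial>hist u t)
         + ennreal (exp (e * (real \<tau> + real qb))) * (\<integral>\<^sup>+x. ennreal (exp (e * load x \<tau> t)) \<partial>hist u t)
         + (\<Sum>r\<in>{\<tau>..<m}. (\<integral>\<^sup>+x. ennreal (exp (e * load x r t)) \<partial>hist u t))
         + (\<Sum>l\<in>{\<tau><..t}. (\<integral>\<^sup>+x. ennreal (of_bool (erred x l)) \<partial>hist u t)))"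
    by (simp add: nn_integral_add nn_integral_sum nn_integral_cmult del: sum_ennreal)
  also have "\<dots> \<le> (\<Sum>l\<in>{m<..t}. ennreal (explore_prob K l)) + (\<Sum>l\<in>{m<..t}. ennreal \<delta>)
      + ennreal (real t) * (ennreal (exp (- e * real qb))
         + ennreal (exp (e * (real \<tau> + real qb))) * ennreal (exp (G \<tau>))
         + (\<Sum>r\<in>{\<tau>..<m}. ennreal (exp (G r)))
         + (\<Sum>l\<in>{\<tau><..t}. ennreal \<delta>))"
    using m by (intro add_mono mult_left_mono sum_mono err G I) (auto simp: nn_integral_explored)
  also have "\<dots> = ennreal ?R"
  proof -
    have c: "(\<Sum>l\<in>{r<..t}. ennreal \<delta>) = ennreal (real (t - r) * \<delta>)" for r
      using \<delta> by (simp add: ennreal_of_nat_eq_real_of_nat ennreal_mult)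
    show ?thesis unfolding c SE SP using \<delta>
      by (intro comb) (auto intro!: sum_nonneg explore_prob_range)
  qed
  finally show ?thesis
    unfolding regret_eq[of u t u] using R0 by (intro integral_le_of_nn_integral_le) auto
qed

end

section \<open>The regret bound\<close>

text \<open>With w the exponential on the right: the first condition keeps exploration up to time t
  small against w, the second controls the truncation of the exploration probability at 1, and the
  third compares (log t)^(4/3) with log t. Only D decides when they hold.\<close>

lemma growth_conditions:
  fixes D :: real
  assumes "D > 0"
  shows "eventually (\<lambda>x::real. 4 * (ln x)\<^sup>2 * (1 + ln x) \<le> exp ((2 * ln x / D) powr (2/3))) at_top"
    "eventually (\<lambda>x::real. 2 * ((2 * ln x / D) powr (2/3))\<^sup>2 \<le> exp ((2 * ln x / D) powr (2/3))) at_top"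
    "eventually (\<lambda>x::real. 10 * ln x \<le> ((2 * ln x / D) powr (2/3))\<^sup>2 * D\<^sup>2 / 32) at_top"
  using assms by real_asymp+

lemma sum_inverse_le_ln:
  assumes "t > 0"
  shows "(\<Sum>l\<in>{0<..t}. 1 / real l) \<le> 1 + ln (real t)"
proof -
  obtain n where t: "t = Suc n" using assms by (cases t) auto
  have "harm (Suc n) - ln (real (Suc n)) \<le> harm (Suc 0) - ln (real (Suc 0))"
    using decseqD[OF decseq_harm_diff_ln, of 0 n] by simp
  hence "harm t \<le> 1 + ln (real t)" by (simp add: t harm_def)
  moreover have "{0<..t} = {1..t}" by auto
  ultimately show ?thesis by (simp add: harm_def field_simps)
qed

lemma explore_prob_le:
  assumes "0 < l" "l \<le> t"
  shows "explore_prob K l \<le> 3 * real K * (ln (real t))\<^sup>2 * (1 / real l)"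
proof -
  have "explore_prob K l \<le> 3 * real K * (ln (real l))\<^sup>2 / real l" by (simp add: explore_prob_def)
  also have "\<dots> \<le> 3 * real K * (ln (real t))\<^sup>2 / real l"
    using assms by (intro divide_right_mono mult_left_mono power_mono) auto
  finally show ?thesis by simp
qed

lemma explore_prob_late_le:
  assumes "real t / 2 \<le> real l" "0 < l" "l \<le> t"
  shows "explore_prob K l \<le> 6 * real K * (ln (real t))\<^sup>2 / real t"
proof -
  have "1 / real l \<le> 2 / real t" using assms by (simp add: field_simps)
  hence "3 * real K * (ln (real t))\<^sup>2 * (1 / real l) \<le> 3 * real K * (ln (real t))\<^sup>2 * (2 / real t)"
    by (intro mult_left_mono) auto
  thus ?thesis using explore_prob_le[OF assms(2,3), of K] by simp
qed

lemma sum_explore_prob_late_le: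
  assumes "real t / 2 \<le> real r" "r \<le> t"
  shows "(\<Sum>l\<in>{r<..t}. explore_prob K l) \<le> real (t - r) * (6 * real K * (ln (real t))\<^sup>2 / real t)"
proof -
  have "(\<Sum>l\<in>{r<..t}. explore_prob K l) \<le> (\<Sum>l\<in>{r<..t}. 6 * real K * (ln (real t))\<^sup>2 / real t)"
    using assms by (intro sum_mono explore_prob_late_le) auto
  thus ?thesis by simp
qed

text \<open>Exploration is dense in early slots, so a bound per slot works only for windows inside
  the second half of time. A longer window has at least t/2 slots, and the harmonic sum bounds all
  exploration up to t by e t / 16.\<close>

lemma sum_explore_prob_le:
  fixes e w :: real
  assumes t: "t > 0" "0 \<le> ln (real t)" and r: "r \<le> t" and e: "e > 0"
    and w: "4 * (ln (real t))\<^sup>2 * (1 + ln (real t)) \<le> w" and Kw: "12 * real K * w \<le> e * real t"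
  shows "(\<Sum>l\<in>{r<..t}. explore_prob K l) \<le> e * real (t - r) / 8"
proof (cases "real t / 2 \<le> real r")
  case True
  let ?L = "ln (real t)"
  have "4 * ?L\<^sup>2 * 1 \<le> 4 * ?L\<^sup>2 * (1 + ?L)" using t by (intro mult_left_mono) auto
  hence "4 * ?L\<^sup>2 \<le> w" using w by simp
  hence "12 * real K * (4 * ?L\<^sup>2) \<le> 12 * real K * w" by (intro mult_left_mono) auto
  hence "6 * real K * ?L\<^sup>2 / real t \<le> e / 8" using Kw t by (simp add: field_simps)
  hence "real (t - r) * (6 * real K * ?L\<^sup>2 / real t) \<le> real (t - r) * (e / 8)"
    by (intro mult_left_mono) auto
  also have "\<dots> = e * real (t - r) / 8" by simp
  finally show ?thesis using sum_explore_prob_late_le[OF True r, of K] by linarith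
next
  case False
  let ?L = "ln (real t)"
  have "(\<Sum>l\<in>{r<..t}. explore_prob K l) \<le> (\<Sum>l\<in>{0<..t}. explore_prob K l)"
    by (intro sum_mono2 explore_prob_range) auto
  also have "\<dots> \<le> (\<Sum>l\<in>{0<..t}. 3 * real K * ?L\<^sup>2 * (1 / real l))"
    by (intro sum_mono explore_prob_le) auto
  also have "\<dots> = 3 * real K * ?L\<^sup>2 * (\<Sum>l\<in>{0<..t}. 1 / real l)"
    by (simp add: sum_distrib_left)
  also have "\<dots> \<le> 3 * real K * ?L\<^sup>2 * (1 + ?L)"
    using t by (intro mult_left_mono sum_inverse_le_ln) auto
  also have "\<dots> = 3 / 4 * real K * (4 * ?L\<^sup>2 * (1 + ?L))" by simp
  also have "\<dots> \<le> 3 / 4 * real K * w" by (intro mult_left_mono w) auto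
  also have "\<dots> \<le> e * real t / 16" using Kw by (simp add: mult_ac)
  also have "\<dots> \<le> e * real (t - r) / 8"
  proof -
    have "real t / 2 \<le> real (t - r)" using False r by (simp add: of_nat_diff)
    hence "e * (real t / 2) \<le> e * real (t - r)" using e by (intro mult_left_mono) auto
    thus ?thesis by simp
  qed
  finally show ?thesis .
qed

text \<open>The slots between w and K w already suffice: there the exploration probability is at least
  min 1 (3 Y^2 / w), where Y = ln w.\<close>
lemma sum_explore_prob_ge:
  fixes Y w :: real
  assumes K: "K \<ge> 2" and w: "w = exp Y" "2 * Y\<^sup>2 \<le> w" and Y: "Y \<ge> 0"
    and l: "K * nat \<lceil>w\<rceil> \<le> l"
  shows "real K * Y\<^sup>2 \<le> (\<Sum>j\<in>{0<..l}. explore_prob K j)"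
proof -
  define n where "n = nat \<lceil>w\<rceil>"
  have wpos: "w > 0" using w by simp
  have n: "w \<le> real n" using wpos unfolding n_def by linarith
  have n0: "real n > 0" using n wpos by linarith
  have p: "min 1 (3 * Y\<^sup>2 / real n) \<le> explore_prob K j" if j: "j \<in> {n<..K * n}" for j
  proof -
    have jn: "real n < real j" using j by simp
    have "Y = ln w" using w by simp
    also have "\<dots> \<le> ln (real j)" using jn n wpos by simp
    finally have "Y\<^sup>2 \<le> (ln (real j))\<^sup>2" using Y by (intro power_mono) auto
    moreover have "real j \<le> real K * real n" using j by (simp flip: of_nat_mult)
    ultimately have "3 * real K * Y\<^sup>2 / (real K * real n) \<le> 3 * real K * (ln (real j))\<^sup>2 / real j"
      using jn n0 K by (intro frac_le mult_left_mono) auto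
    moreover have "3 * real K * Y\<^sup>2 / (real K * real n) = 3 * Y\<^sup>2 / real n" using K by simp
    ultimately show ?thesis by (auto simp: explore_prob_def)
  qed
  have m: "2 * Y\<^sup>2 \<le> real n * min 1 (3 * Y\<^sup>2 / real n)"
  proof -
    have "real n * min 1 (3 * Y\<^sup>2 / real n) = min (real n) (3 * Y\<^sup>2)"
      using n0 by (auto simp: min_def field_simps)
    moreover have "2 * Y\<^sup>2 \<le> 3 * Y\<^sup>2" by simp
    ultimately show ?thesis using w(2) n by simp
  qed
  have "real K * Y\<^sup>2 = real K / 2 * (2 * Y\<^sup>2)" by simp
  also have "\<dots> \<le> real K / 2 * (real n * min 1 (3 * Y\<^sup>2 / real n))"
    by (intro mult_left_mono m) auto
  \<comment> \<open>There are (K - 1) n slots between n and K n, and K - 1 >= K / 2 since K >=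
    2.\<close>
  also have "\<dots> \<le> (real K - 1) * (real n * min 1 (3 * Y\<^sup>2 / real n))"
    using K by (intro mult_right_mono) auto
  also have "\<dots> = real (card {n<..K * n}) * min 1 (3 * Y\<^sup>2 / real n)"
    using K by (simp add: of_nat_diff algebra_simps)
  also have "\<dots> = (\<Sum>j\<in>{n<..K * n}. min 1 (3 * Y\<^sup>2 / real n))" by simp
  also have "\<dots> \<le> (\<Sum>j\<in>{n<..K * n}. explore_prob K j)" by (intro sum_mono p)
  also have "\<dots> \<le> (\<Sum>j\<in>{0<..l}. explore_prob K j)"
    using l unfolding n_def by (intro sum_mono2 explore_prob_range) auto
  finally show ?thesis .
qed

context queueing_bandit
begin

text \<open>The target t^-5 pays for a union over at most t slots and for the crude factor t of the
  regret, leaving t^-3. It is reached from t^-10: there are at most t^2 pairs, and the prefactors of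
  the tails cost at most another t^2.\<close>

lemma erred_prob_le:
  fixes D Y :: real and t :: nat
  assumes gap: "\<And>v k. v < U \<Longrightarrow> k < K \<Longrightarrow> k \<noteq> ks v \<Longrightarrow> mu v (ks v) - mu v k \<ge> D"
    and D: "0 < D" "D \<le> 1" and K: "2 \<le> K" "K \<le> t" and u: "u < U"
    and Y: "Y > 0" "2 * Y\<^sup>2 \<le> exp Y" "10 * ln (real t) \<le> Y\<^sup>2 * D\<^sup>2 / 32"
    and t: "7 \<le> t" and l: "l \<in> {K * nat \<lceil>exp Y\<rceil><..t}"
  shows "(\<integral>\<^sup>+x. ennreal (of_bool (erred x l)) \<partial>hist u t) \<le> ennreal (exp (- 5 * ln (real t)))"
proof -
  let ?L = "ln (real t)"
  obtain l' where l': "l = Suc l'" using l by (cases l) auto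
  have t0: "real t > 0" using t by simp
  have tL: "exp ?L = real t" using t0 by simp
  \<comment> \<open>Exploration up to \<open>l'\<close> puts Y^2 / 2 into the exponent. Half of it
    is spent on the threshold and the other half exceeds Z because D <= 1, so both kinds of failure
    are at most exp (- Z).\<close>
  define N where "N = Y\<^sup>2 / 4"
  define Z where "Z = Y\<^sup>2 * D\<^sup>2 / 32"
  define S where "S = (\<Sum>j\<in>{0<..l'}. explore_prob K j)"
  have N: "N > 0" using Y by (simp add: N_def)
  have NZ: "- N * D\<^sup>2 / 8 = - Z" by (simp add: N_def Z_def)
  have "real K * Y\<^sup>2 \<le> S"
    unfolding S_def by (rule sum_explore_prob_ge[OF K(1) refl]) (use Y l l' in auto)
  hence "Y\<^sup>2 / 2 \<le> S / (2 * real K)" using K by (simp add: field_simps)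
  moreover have "Z \<le> Y\<^sup>2 / 4"
  proof -
    have "Y\<^sup>2 * D\<^sup>2 \<le> Y\<^sup>2 * 1" using D by (intro mult_left_mono power_le_one) auto
    moreover have "0 \<le> Y\<^sup>2" by simp
    ultimately show ?thesis unfolding Z_def by linarith
  qed
  ultimately have NS: "N - S / (2 * real K) \<le> - Z" unfolding N_def by linarith
  have "(\<integral>\<^sup>+x. ennreal (of_bool (erred x l)) \<partial>hist u t)
     \<le> (\<integral>\<^sup>+x. emeasure (khat_pmf U K (cur x)) {kh. \<exists>v<U. kh v \<noteq> ks v} \<partial>hist u l')"
    unfolding l' using l l' by (intro nn_integral_erred_le u) auto
  also have "\<dots> \<le> ennreal (real U * real K * (exp (N - S / (2 * real K)) + (2 * real l' + 4) * exp (- N * D\<^sup>2 / 8)))"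
    unfolding S_def by (rule exploit_error_le[OF gap D(1) N])
  also have "\<dots> \<le> ennreal (exp (- 5 * ?L))"
  proof (rule ennreal_leI)
    have "real U * real K * (exp (N - S / (2 * real K)) + (2 * real l' + 4) * exp (- N * D\<^sup>2 / 8))
       \<le> real t * real t * (exp (- Z) + (2 * real l' + 4) * exp (- Z))"
      unfolding NZ using NS K U_le_K by (intro mult_mono add_mono) auto
    also have "\<dots> = real t * real t * ((2 * real l' + 5) * exp (- Z))" by (simp add: algebra_simps)
    also have "\<dots> \<le> real t * real t * ((real t * real t) * exp (- 10 * ?L))"
    proof (intro mult_left_mono mult_mono)
      have "real l' \<le> real t" using l l' by simp
      hence "2 * real l' + 5 \<le> 7 * real t" using t by linarith
      also have "\<dots> \<le> real t * real t" using t by (intro mult_right_mono) auto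
      finally show "2 * real l' + 5 \<le> real t * real t" .
      show "exp (- Z) \<le> exp (- 10 * ?L)" using Y(3) unfolding Z_def by simp
    qed auto
    also have "\<dots> = exp ?L * exp ?L * ((exp ?L * exp ?L) * exp (- 10 * ?L))" unfolding tL ..
    also have "\<dots> = exp (- 6 * ?L)" by (simp flip: exp_add)
    also have "\<dots> \<le> exp (- 5 * ?L)" using t by simp
    finally show "real U * real K * (exp (N - S / (2 * real K)) + (2 * real l' + 4) * exp (- N * D\<^sup>2 / 8))
       \<le> exp (- 5 * ?L)" .
  qed
  finally show ?thesis .
qed

lemma regret_bound:
  fixes D :: real and t :: nat
  assumes gap: "\<And>v k. v < U \<Longrightarrow> k < K \<Longrightarrow> k \<noteq> ks v \<Longrightarrow> mu v (ks v) - mu v k \<ge> D"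
    and D: "0 < D" "D \<le> 1" and K: "2 \<le> K" and u: "u < U" and t: "7 \<le> t"
    and E2: "4 * (ln (real t))\<^sup>2 * (1 + ln (real t)) \<le> wfun D t"
    and E3: "2 * ((2 * ln (real t) / D) powr (2/3))\<^sup>2 \<le> wfun D t"
    and E4: "10 * ln (real t) \<le> ((2 * ln (real t) / D) powr (2/3))\<^sup>2 * D\<^sup>2 / 32"
    and vv: "vfun K (epsq K lam mu u) D t + vpfun K (epsq K lam mu u) D t \<le> real t / 2"
  shows "regret U K lam mu Em sel st u t \<le>
     12 * (real K * vfun K (epsq K lam mu u) D t * (ln (real t))\<^sup>2 / real t)"
proof -
  define L where "L = ln (real t)"
  define e where "e = epsq K lam mu u"
  define w where "w = wfun D t"
  define Y where "Y = (2 * L / D) powr (2/3)"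
  define v where "v = vfun K e D t"
  define \<tau> where "\<tau> = K * nat \<lceil>w\<rceil>"
  \<comment> \<open>Rounding v down is enough: a window starting strictly before m has at least one
    more slot, hence length at least v.\<close>
  define m where "m = t - nat \<lfloor>v\<rfloor>"
  \<comment> \<open>Chosen so that the stationary tail beyond \<open>qb\<close> is at most
    t^-3.\<close>
  define qb where "qb = nat \<lceil>3 * L / e\<rceil>"
  define X where "X = real K * v * L\<^sup>2 / real t"
  have e: "0 < e" "e \<le> 1" using eps_pos[OF u] eps_le_1[OF u] by (auto simp: e_def)
  have t0: "real t > 0" using t by simp
  have tL: "exp L = real t" using t0 by (simp add: L_def)
  have L1: "L \<ge> 1"
  proof -
    have "exp 1 \<le> real t" using t exp_le by linarith
    thus ?thesis using t0 by (simp add: L_def ln_ge_iff)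
  qed
  have w: "w = exp Y" by (simp add: w_def wfun_def Y_def L_def)
  have Y0: "Y > 0" using L1 D by (simp add: Y_def)
  have w1: "w > 1" using Y0 w by simp
  have v1: "24 / e\<^sup>2 * L \<le> v"
    using e w1 t0 unfolding v_def vfun_def vpfun_def L_def[symmetric] w_def[symmetric] by simp
  have v24: "24 \<le> v"
  proof -
    have "24 * 1 \<le> 24 / e\<^sup>2 * L"
      using e L1 by (intro mult_mono) (auto simp: field_simps power_le_one)
    thus ?thesis using v1 by linarith
  qed
  have vp: "vpfun K e D t = 6 * real K / e * w" by (simp add: vpfun_def w_def)
  have vp0: "0 \<le> 6 * real K / e * w" using e w1 by simp
  have "6 * real K / e * w \<le> real t / 2"
    using vv v24 unfolding e_def[symmetric] vp v_def[symmetric] by linarith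
  \<comment> \<open>This is v' <= t/2 cleared of denominators. It bounds both the initial phase
    (\<open>\<tau>1\<close>) and the exploration within any window (\<open>sp\<close>). In the same
    way \<open>eet\<close> draws from v <= t/2 that e^2 t dominates log t.\<close>
  hence Kw: "12 * real K * w \<le> e * real t" using e by (simp add: field_simps)
  have vt: "v \<le> real t / 2" using vv vp0 unfolding e_def[symmetric] vp v_def[symmetric] by linarith
  have eet: "48 * L \<le> e\<^sup>2 * real t"
  proof -
    have "24 / e\<^sup>2 * L \<le> real t / 2" using v1 vt by linarith
    thus ?thesis using e by (simp add: field_simps)
  qed
  have Kt: "K \<le> t"
  proof -
    have "real K * 1 \<le> 12 * real K * w" using w1 by (intro order_trans[OF mult_left_mono[of 1 w "real K"]]) auto
    also have "\<dots> \<le> 1 * real t" using Kw e t0 by (intro order_trans[OF Kw] mult_right_mono) auto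
    finally show ?thesis by simp
  qed
  have \<tau>1: "real \<tau> \<le> e * real t / 6"
  proof -
    have "real (nat \<lceil>w\<rceil>) \<le> 2 * w" using w1 by linarith
    hence "real \<tau> \<le> real K * (2 * w)" unfolding \<tau>_def of_nat_mult by (intro mult_left_mono) auto
    thus ?thesis using Kw by linarith
  qed
  have \<tau>2: "real \<tau> \<le> real t / 6"
  proof -
    have "e * real t \<le> 1 * real t" using e t0 by (intro mult_right_mono) auto
    thus ?thesis using \<tau>1 by linarith
  qed
  have fl: "real (nat \<lfloor>v\<rfloor>) \<le> v" "v \<le> real (nat \<lfloor>v\<rfloor>) + 1" using v24 by linarith+
  have m1: "m \<le> t" "real m = real t - real (nat \<lfloor>v\<rfloor>)" "real (t - m) = real (nat \<lfloor>v\<rfloor>)"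
    unfolding m_def using fl vt by (auto simp: of_nat_diff)
  have m2: "real t / 2 \<le> real m" using m1 fl vt by linarith
  have \<tau>m: "\<tau> \<le> m" using \<tau>2 m2 t0 by linarith
  have E2': "4 * L\<^sup>2 * (1 + L) \<le> w" using E2 by (simp add: L_def w_def)
  have sp: "(\<Sum>l\<in>{r<..t}. explore_prob K l) \<le> e * real (t - r) / 8" if "r \<le> t" for r
    using sum_explore_prob_le[of t r e w K] t0 L1 that e E2' Kw unfolding L_def by simp
  define G where "G = (\<lambda>r. - (3/4) * e\<^sup>2 * real (t - r) + 2 * e * (\<Sum>l\<in>{r<..t}. explore_prob K l))"
  have G: "G r \<le> - e\<^sup>2 * real (t - r) / 2" if "r \<le> t" for r
  proof -
    have "2 * e * (\<Sum>l\<in>{r<..t}. explore_prob K l) \<le> 2 * e * (e * real (t - r) / 8)"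
      using sp[OF that] e by (intro mult_left_mono) auto
    thus ?thesis unfolding G_def by (simp add: power2_eq_square)
  qed
  have err: "(\<integral>\<^sup>+x. ennreal (of_bool (erred x l)) \<partial>hist u t) \<le> ennreal (exp (- 5 * L))" if "l \<in> {\<tau><..t}" for l
    using erred_prob_le[OF gap D K Kt u Y0 _ _ t, of l] E3 E4 that
    unfolding L_def[symmetric] Y_def[symmetric] w_def[symmetric] \<tau>_def w by simp
  have bound: "regret U K lam mu Em sel st u t \<le>
     (\<Sum>l\<in>{m<..t}. explore_prob K l) + real (t - m) * exp (- 5 * L)
     + real t * (exp (- e * real qb) + exp (e * (real \<tau> + real qb)) * exp (G \<tau>)
         + (\<Sum>r\<in>{\<tau>..<m}. exp (G r)) + real (t - \<tau>) * exp (- 5 * L))"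
    unfolding e_def G_def by (rule regret_le[OF u \<tau>m m1(1) _ err]) auto
  have tm: "real (t - m) \<le> v" using m1(3) fl(1) by linarith
  have b1: "(\<Sum>l\<in>{m<..t}. explore_prob K l) \<le> 6 * X"
  proof -
    have "(\<Sum>l\<in>{m<..t}. explore_prob K l) \<le> real (t - m) * (6 * real K * L\<^sup>2 / real t)"
      using sum_explore_prob_late_le[OF m2 m1(1)] unfolding L_def .
    also have "\<dots> \<le> v * (6 * real K * L\<^sup>2 / real t)" using tm by (intro mult_right_mono) auto
    finally show ?thesis by (simp add: X_def mult_ac)
  qed
  have small: "exp (- 2 * L) \<le> 1 / real t"
  proof -
    have "exp (- 2 * L) \<le> exp (- L)" using L1 by simp
    thus ?thesis by (simp add: exp_minus tL inverse_eq_divide)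
  qed
  have b2: "real (t - m) * exp (- 5 * L) \<le> v * (1 / real t)"
    using tm v24 L1 by (intro mult_mono order_trans[OF _ small]) auto
  have b3: "exp (- e * real qb) \<le> exp (- 3 * L)"
  proof -
    have "3 * L / e \<le> real qb" unfolding qb_def by linarith
    thus ?thesis using e by (simp add: field_simps)
  qed
  \<comment> \<open>The initial length contributes 4 L, the initial phase e^2 t / 6, the drift
    afterwards - (5/12) e^2 t. The sum is 4 L - e^2 t / 4, and \<open>eet\<close> makes it at most
    -8 L.\<close>
  have b4: "exp (e * (real \<tau> + real qb)) * exp (G \<tau>) \<le> exp (- 3 * L)"
  proof -
    have "0 \<le> 3 * L / e" using L1 e by simp
    hence "real qb \<le> 3 * L / e + 1" unfolding qb_def by linarith
    hence "e * real qb \<le> e * (3 * L / e + 1)" using e by (intro mult_left_mono) auto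
    also have "\<dots> \<le> 4 * L" using e L1 by (simp add: distrib_left)
    finally have 1: "e * real qb \<le> 4 * L" .
    have 2: "e * real \<tau> \<le> e\<^sup>2 * real t / 6"
      using mult_left_mono[OF \<tau>1, of e] e by (simp add: power2_eq_square)
    have "5 / 6 * real t \<le> real (t - \<tau>)" using \<tau>2 by (simp add: of_nat_diff)
    hence "e\<^sup>2 * (5 / 6 * real t) \<le> e\<^sup>2 * real (t - \<tau>)" by (intro mult_left_mono) auto
    moreover have "G \<tau> \<le> - e\<^sup>2 * real (t - \<tau>) / 2" using \<tau>m m1(1) by (intro G) auto
    ultimately have "G \<tau> \<le> - (5 / 12) * (e\<^sup>2 * real t)" by simp
    hence "e * (real \<tau> + real qb) + G \<tau> \<le> - 3 * L"
      using 1 2 eet L1 by (simp add: distrib_left)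
    thus ?thesis by (simp flip: exp_add)
  qed
  \<comment> \<open>Here the first term of v is decisive: windows of length at least v have exponent
    at most -12 L, which leaves ample room for summing over at most t of them.\<close>
  have b5: "(\<Sum>r\<in>{\<tau>..<m}. exp (G r)) \<le> exp (- 3 * L)"
  proof -
    have "exp (G r) \<le> exp (- 12 * L)" if r: "r \<in> {\<tau>..<m}" for r
    proof -
      have "real r + 1 \<le> real m" "real (t - r) = real t - real r" using r m1(1) by (auto simp: of_nat_diff)
      hence "v \<le> real (t - r)" using m1(2) fl(2) by linarith
      hence "e\<^sup>2 * (24 / e\<^sup>2 * L) \<le> e\<^sup>2 * real (t - r)" using v1 by (intro mult_left_mono) auto
      hence "24 * L \<le> e\<^sup>2 * real (t - r)" using e by simp
      thus ?thesis using G[of r] r m1(1) by simp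
    qed
    hence "(\<Sum>r\<in>{\<tau>..<m}. exp (G r)) \<le> (\<Sum>r\<in>{\<tau>..<m}. exp (- 12 * L))" by (intro sum_mono)
    also have "\<dots> \<le> real t * exp (- 12 * L)" using m1(1) by (simp add: mult_right_mono)
    also have "\<dots> = exp (- 11 * L)" by (simp flip: tL exp_add)
    also have "\<dots> \<le> exp (- 3 * L)" using L1 by simp
    finally show ?thesis .
  qed
  have b6: "real (t - \<tau>) * exp (- 5 * L) \<le> exp (- 3 * L)"
  proof -
    have "real (t - \<tau>) * exp (- 5 * L) \<le> exp L * exp (- 5 * L)"
      unfolding tL by (intro mult_right_mono) auto
    also have "\<dots> \<le> exp (- 3 * L)" using L1 by (simp flip: exp_add)
    finally show ?thesis .
  qed
  have "real t * (exp (- e * real qb) + exp (e * (real \<tau> + real qb)) * exp (G \<tau>)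
         + (\<Sum>r\<in>{\<tau>..<m}. exp (G r)) + real (t - \<tau>) * exp (- 5 * L)) \<le> exp L * (4 * exp (- 3 * L))"
    unfolding tL using b3 b4 b5 b6 by (intro mult_left_mono) linarith+
  also have "\<dots> = 4 * exp (- 2 * L)" by (simp flip: exp_add)
  also have "\<dots> \<le> 4 * (1 / real t)" using small by simp
  finally have b7: "real t * (exp (- e * real qb) + exp (e * (real \<tau> + real qb)) * exp (G \<tau>)
         + (\<Sum>r\<in>{\<tau>..<m}. exp (G r)) + real (t - \<tau>) * exp (- 5 * L)) \<le> 4 * (1 / real t)" .
  have X1: "v * (1 / real t) \<le> X"
  proof -
    have "1 * 1 \<le> real K * L\<^sup>2" using K L1 by (intro mult_mono) (auto simp: one_le_power)
    hence "v * 1 \<le> v * (real K * L\<^sup>2)" using v24 by (intro mult_left_mono) auto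
    thus ?thesis using t0 unfolding X_def by (simp add: divide_right_mono mult_ac)
  qed
  have X2: "1 / real t \<le> v * (1 / real t)" using v24 t0 by (simp add: divide_right_mono)
  have X3: "0 \<le> X" using X1 X2 t0 by (meson divide_nonneg_nonneg of_nat_0_le_iff order_trans zero_le_one)
  \<comment> \<open>The contributions are 6 X from exploration, X from errors after m and 4 X from
    the exceptional events.\<close>
  have "regret U K lam mu Em sel st u t \<le> 12 * X"
    using bound b1 b2 b7 X1 X2 X3 by linarith
  thus ?thesis unfolding X_def v_def e_def L_def .
qed

text \<open>With one server \<open>gapDelta\<close> is a minimum over the empty set and carries no
  information. But then every decision assigns the only server, so the two queues coincide.\<close>

lemma regret_single_server:
  assumes K: "K = 1" and u: "u < U"
  shows "regret U K lam mu Em sel st u t = 0"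
proof -
  have ks0: "ks v = 0" if "v < U" for v using ks_props(1)[OF that] K by simp
  have dec: "snd c u = Some (ks u)" if c: "c \<in> set_pmf (decision t s)" for c t s
  proof -
    have one: "k = ks v" if "v < U" "k < K" for k v using ks0[OF that(1)] that(2) K by simp
    have "Em i u = Some (ks u)" if i: "i < K" for i
    proof -
      obtain j where j: "j < K" "Em j u = Some (ks u)" using Em_cover[OF u ks_props(1)[OF u]] by auto
      have "i = j" using i j(1) K by simp
      thus ?thesis using j(2) by simp
    qed
    moreover have "sel t s kh u = Some (ks u)" if "kh \<in> set_pmf (khat_pmf U K s)" for kh
      using set_khat_pmf[OF K_pos, of U s] that
      by (intro sel_correct u one) (auto simp: khat_range_def)
    moreover have "set_pmf (pmf_of_set {..<K}) = {..<K}"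
      using K_pos by (intro set_pmf_of_set) auto
    ultimately show ?thesis
      using c unfolding decision_def by (auto split: if_splits)
  qed
  have "Qa (cur x) u = Qg (cur x) u" if "x \<in> set_pmf (hist u t)" for x
    using that
  proof (induction t arbitrary: x)
    case (Suc t)
    then obtain y A R c where y: "y \<in> set_pmf (hist u t)" "c \<in> set_pmf (decision (Suc t) (cur y))"
      "x = next_history u (Suc t) y A R c" by auto
    thus ?case using Suc.IH[OF y(1)] dec[OF y(2)] by (simp add: next_history_def qupd_def)
  qed auto
  hence "(\<integral>x. real (Qa (cur x) u) - real (Qg (cur x) u) \<partial>hist u t) = (\<integral>x. 0 \<partial>hist u t)"
    by (intro integral_cong_AE) (auto simp: AE_measure_pmf_iff)
  thus ?thesis by (simp add: regret_eq[of u t u])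
qed

lemma gapDelta_props:
  assumes K: "2 \<le> K"
  shows "0 < gapDelta U K mu" "gapDelta U K mu \<le> 1"
    and "v < U \<Longrightarrow> k < K \<Longrightarrow> k \<noteq> ks v \<Longrightarrow> gapDelta U K mu \<le> mu v (ks v) - mu v k"
proof -
  define S where "S = {mustar K mu u - mu u k | u k. u < U \<and> k < K \<and> k \<noteq> kstar K mu u}"
  have "S \<subseteq> (\<lambda>(u, k). mustar K mu u - mu u k) ` ({..<U} \<times> {..<K})" by (auto simp: S_def)
  hence fin: "finite S" by (rule finite_subset) auto
  have "\<exists>k<K. k \<noteq> ks 0" using K by (cases "ks 0 = 0") (auto intro: exI[of _ 1] exI[of _ 0])
  hence ne: "S \<noteq> {}" using U_pos by (fastforce simp: S_def)
  have gS: "gapDelta U K mu = Min S" by (simp add: gapDelta_def S_def)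
  have rng: "0 < z \<and> z \<le> 1" if "z \<in> S" for z
  proof -
    from that obtain v k where vk: "v < U" "k < K" "k \<noteq> ks v" "z = mustar K mu v - mu v k"
      by (auto simp: S_def)
    have "mu v k \<le> mustar K mu v" unfolding mustar_def using vk by (intro Max_ge) auto
    moreover have "mu v k \<noteq> mustar K mu v" using ks_props(3)[OF vk(1,2)] vk(3) by auto
    moreover have "mustar K mu v \<le> 1" using mu_range[OF vk(1) ks_props(1)[OF vk(1)]] ks_props(2)[OF vk(1)] by simp
    ultimately show ?thesis using vk mu_range[OF vk(1,2)] by simp
  qed
  show "0 < gapDelta U K mu" "gapDelta U K mu \<le> 1" using rng[OF Min_in[OF fin ne]] by (auto simp: gS)
  show "gapDelta U K mu \<le> mu v (ks v) - mu v k" if "v < U" "k < K" "k \<noteq> ks v"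
    unfolding gS using fin that ks_props(2)[OF that(1)] by (intro Min_le) (auto simp: S_def)
qed

lemma vfun_nonneg:
  assumes "u < U" "1 \<le> t"
  shows "0 \<le> vfun K (epsq K lam mu u) D t"
  using eps_pos[OF assms(1)] assms(2) by (simp add: vfun_def vpfun_def wfun_def)

end

lemma uniform_regret_bound:
  fixes D :: real
  shows "\<exists>t0. \<forall>U K lam mu Em sel st u t. queueing_bandit U K lam mu Em sel st \<and> gapDelta U K mu = D \<and>
     u < U \<and> t0 < real t \<and>
     vfun K (epsq K lam mu u) D t + vpfun K (epsq K lam mu u) D t \<le> real t / 2 \<longrightarrow>
     regret U K lam mu Em sel st u t
       \<le> 12 * (real K * vfun K (epsq K lam mu u) D t * (ln (real t))\<^sup>2 / real t)"
proof -
  define E where "E = (\<lambda>x::real. 4 * (ln x)\<^sup>2 * (1 + ln x) \<le> exp ((2 * ln x / D) powr (2/3)) \<and>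
     2 * ((2 * ln x / D) powr (2/3))\<^sup>2 \<le> exp ((2 * ln x / D) powr (2/3)) \<and>
     10 * ln x \<le> ((2 * ln x / D) powr (2/3))\<^sup>2 * D\<^sup>2 / 32)"
  \<comment> \<open>The threshold has to be fixed before the instance. For D <= 0 any value will do:
    instances with two or more servers have a positive gap, and a single server incurs no
    regret.\<close>
  have "\<exists>t0. D > 0 \<longrightarrow> (\<forall>x\<ge>t0. E x)"
  proof (cases "D > 0")
    case True
    have "eventually E at_top"
      unfolding E_def by (intro eventually_conj growth_conditions True)
    thus ?thesis by (auto simp: eventually_at_top_linorder)
  qed auto
  then obtain t1 where t1: "\<And>x. D > 0 \<Longrightarrow> x \<ge> t1 \<Longrightarrow> E x" by auto
  show ?thesis
  proof (intro exI[of _ "max 7 t1"] allI impI; elim conjE)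
    fix U K :: nat and lam mu Em sel st u t
    assume "queueing_bandit U K lam mu Em sel st"
      and D: "gapDelta U K mu = D" and u: "u < U" and t: "max 7 t1 < real t"
      and vv: "vfun K (epsq K lam mu u) D t + vpfun K (epsq K lam mu u) D t \<le> real t / 2"
    then interpret queueing_bandit U K lam mu Em sel st by simp
    show "regret U K lam mu Em sel st u t
            \<le> 12 * (real K * vfun K (epsq K lam mu u) D t * (ln (real t))\<^sup>2 / real t)"
    proof (cases "2 \<le> K")
      case True
      note g = gapDelta_props[OF True, unfolded D]
      have "E (real t)" using t1[OF g(1)] t by simp
      thus ?thesis
        using t by (intro regret_bound g True u vv) (auto simp: E_def wfun_def)
    next
      case False
      hence "K = 1" using K_pos by simp
      hence "regret U K lam mu Em sel st u t = 0" using u by (intro regret_single_server)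
      moreover have "0 \<le> vfun K (epsq K lam mu u) D t" using t by (intro vfun_nonneg u) auto
      ultimately show ?thesis by simp
    qed
  qed
qed

theorem theorem4:
  "\<forall>D::real. \<exists>C::real. C > 0 \<and> (\<exists>t0::real.
     \<forall>U K (lam :: nat \<Rightarrow> real) (mu :: nat \<Rightarrow> nat \<Rightarrow> real)
       (Em :: nat \<Rightarrow> nat \<Rightarrow> nat option)
       (sel :: nat \<Rightarrow> qstate \<Rightarrow> (nat \<Rightarrow> nat) \<Rightarrow> nat \<Rightarrow> nat option)
       (st :: nat \<Rightarrow> nat pmf).
       1 \<le> U \<and> U \<le> K
       \<and> (\<forall>u<U. 0 \<le> lam u \<and> lam u \<le> 1)
       \<and> (\<forall>u<U. \<forall>k<K. 0 \<le> mu u k \<and> mu u k \<le> 1)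
       \<and> (\<forall>u<U. \<exists>!k. k < K \<and> mu u k = mustar K mu u)
       \<and> inj_on (kstar K mu) {..<U}
       \<and> (\<forall>u<U. epsq K lam mu u > 0)
       \<and> (\<forall>i<K. is_matching U K (Em i))
       \<and> (\<forall>u<U. \<forall>k<K. \<exists>i<K. Em i u = Some k)
       \<and> (\<forall>t s kh. (\<forall>u<U. kh u < K) \<longrightarrow>
             is_matching U K (sel t s kh) \<and>
             (\<forall>\<kappa>. is_matching U K \<kappa> \<longrightarrow> mismatch U (sel t s kh) kh \<le> mismatch U \<kappa> kh))
       \<and> (\<forall>u<U. queue_stationary (lam u) (mustar K mu u) (st u))
       \<and> gapDelta U K mu = D
       \<longrightarrow>
       (\<forall>u<U. \<forall>t::nat.
          real t > t0
          \<and> wfun D t / ln (real t) \<ge> 2 / epsq K lam mu u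
          \<and> real t \<ge> exp (6 / D^2)
          \<and> vfun K (epsq K lam mu u) D t + vpfun K (epsq K lam mu u) D t \<le> real t / 2
          \<longrightarrow>
          regret U K lam mu Em sel st u t
            \<le> C * (real K * vfun K (epsq K lam mu u) D t * (ln (real t))^2 / real t)))"
proof (rule allI, goal_cases)
  case (1 D)
  obtain t0 where t0: "\<And>U K lam mu Em sel st u t. queueing_bandit U K lam mu Em sel st \<Longrightarrow>
     gapDelta U K mu = D \<Longrightarrow> u < U \<Longrightarrow> t0 < real t \<Longrightarrow>
     vfun K (epsq K lam mu u) D t + vpfun K (epsq K lam mu u) D t \<le> real t / 2 \<Longrightarrow>
     regret U K lam mu Em sel st u t
       \<le> 12 * (real K * vfun K (epsq K lam mu u) D t * (ln (real t))\<^sup>2 / real t)"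
    using uniform_regret_bound[of D] by blast
  show ?case
  proof (rule exI[of _ 12], rule conjI, simp, rule exI[of _ t0], intro allI impI, elim conjE, goal_cases)
    case (1 U K lam mu Em sel st u t)
    have "queueing_bandit U K lam mu Em sel st"
      by unfold_locales (use 1 in auto)
    thus ?case using 1 by (intro t0) auto
  qed
qed

end
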